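(* Let $\alpha>-1$ and $t\in\mathbb{R}$ be fixed. The sub-leading coefficient $\mathrm{p}(n,t)$ has the asymptotic expansion as $n\to\infty$ $$\mathrm{p}(n,t)=b_{-1}n+b_0+\sum_{j=1}^{\infty}\frac{b_j}{n^j}$$ (that is, there are numbers $b_j=b_j(\alpha,t)$ such that $\mathrm{p}(n,t)=b_{-1}n+b_0+\sum_{j=1}^{N}b_jn^{-j}+O(n^{-N-1})$ as $n\to\infty$ for every $N\ge1$), where the first few coefficients are $$b_{-1}=-\tfrac14,\qquad b_0=\tfrac1{16}(t+2+4\alpha),\qquad b_1=\tfrac1{16}(1-4\alpha^2),$$ $$b_2=\tfrac1{32}(1-4\alpha^2)(t+1-2\alpha),\qquad b_3=\tfrac1{64}(1-4\alpha^2)(t+1-2\alpha)^2,$$ $$b_4=\tfrac1{256}(1-4\alpha^2)\left[2t^3+6(1-2\alpha)t^2+(20\alpha^2-24\alpha+15)t+2(1-2\alpha)^3\right],$$ $$b_5=\tfrac1{256}(1-4\alpha^2)\left[t^4+4(1-2\alpha)t^3+8(2\alpha^2-3\alpha+3)t^2+2(1-2\alpha)(4\alpha^2-8\alpha+11)t+(1-2\alpha)^4\right].$$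
   Context: For $\alpha>-1$ and $t\in\mathbb{R}$ let $w(x,t)=(1-x^2)^{\alpha}e^{-tx^2}$, $x\in[-1,1]$. Let $P_n(x,t)$, $n=0,1,2,\ldots$, be the monic polynomials of degree $n$ orthogonal with respect to $w$ on $[-1,1]$, i.e. $\int_{-1}^1P_m(x,t)P_n(x,t)w(x,t)\,dx=0$ for $m\ne n$. Since $w$ is even, $P_n(x,t)=x^n+\mathrm{p}(n,t)x^{n-2}+\cdots$, which defines $\mathrm{p}(n,t)$ for $n\ge2$; by definition $\mathrm{p}(0,t)=\mathrm{p}(1,t)=0$. The infinite series is an asymptotic (not necessarily convergent) expansion. *)

theory Defs
  imports
    "HOL-Analysis.Analysis"
    "HOL-Computational_Algebra.Polynomial"
    "HOL-Library.Landau_Symbols"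
begin

(* At x = 1 and x = -1 the base of powr is 0 and the value is 0 by the convention 0 powr a = 0;
   these two points form a null set and do not affect the integrals below. *)
definition jacobi_weight :: "real \<Rightarrow> real \<Rightarrow> real \<Rightarrow> real" where
  "jacobi_weight \<alpha> t x = (1 - x\<^sup>2) powr \<alpha> * exp (- t * x\<^sup>2)"

definition monic_orthogonal_polys :: "real \<Rightarrow> real \<Rightarrow> (nat \<Rightarrow> real poly) \<Rightarrow> bool" where
  "monic_orthogonal_polys \<alpha> t P \<longleftrightarrow>
     (\<forall>n. degree (P n) = n \<and> lead_coeff (P n) = 1) \<and>
     (\<forall>m n. m \<noteq> n \<longrightarrow>
        (LINT x:{-1..1}|lborel. poly (P m) x * poly (P n) x * jacobi_weight \<alpha> t x) = 0)"

(* The weight is even, so P n contains only powers of the same parity as n; the "sub-leading"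
   coefficient is therefore the one of x^(n-2), not of x^(n-1). *)
definition subleading :: "(nat \<Rightarrow> real poly) \<Rightarrow> nat \<Rightarrow> real" where
  "subleading P n = (if n < 2 then 0 else coeff (P n) (n - 2))"

end

theory Submission
  imports Defs "HOL-Computational_Algebra.Polynomial_FPS"
begin

text \<open>
  Write \<open>L f\<close> for the integral of \<open>f w\<close> over \<open>[-1,1]\<close>, \<open>\<sigma> = 1 - x\<^sup>2\<close> and
  \<open>\<tau> = - 2 (1 + \<alpha> + t) x + 2 t x\<^sup>3\<close>.  The weight solves the Pearson equation \<open>(\<sigma> w)' = \<tau> w\<close>,
  and \<open>\<sigma> w\<close> vanishes at both endpoints, so \<open>L (\<sigma> f' + \<tau> f) = 0\<close> for every polynomial \<open>f\<close>.
  The other facts about the weight that matter are positivity, evenness and \<open>\<bar>x\<bar> \<le> 1\<close> on its support.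
  Together with the recurrence \<open>x P\<^sub>n = P\<^sub>n\<^sub>+\<^sub>1 + \<beta>\<^sub>n P\<^sub>n\<^sub>-\<^sub>1\<close> they give a structure relation
  that expresses \<open>\<sigma> P\<^sub>n'\<close> through \<open>P\<^sub>n\<^sub>+\<^sub>1\<close>, \<open>P\<^sub>n\<^sub>-\<^sub>1\<close> and \<open>P\<^sub>n\<^sub>-\<^sub>3\<close>, with
  coefficients that are polynomials in the \<open>\<beta>\<close>s (\<open>structure_relation\<close>).  It is used twice.

  \<^item> Comparing the coefficients of \<open>x^(n-1)\<close> gives the subleading coefficient as a polynomial in
    \<open>n\<close> and \<open>\<beta>\<^sub>n\<^sub>-\<^sub>1\<close>, \<open>\<beta>\<^sub>n\<close>, \<open>\<beta>\<^sub>n\<^sub>+\<^sub>1\<close> (\<open>subleading_formula\<close>).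
  \<^item> At \<open>x = 1\<close> the left-hand side vanishes, which by the recurrence leaves a homogeneous linear relation between
    \<open>P\<^sub>n(1)\<close> and \<open>P\<^sub>n\<^sub>-\<^sub>1(1)\<close>.  The relation for \<open>n - 1\<close> is another one between the same two
    numbers; they are not both zero, so the determinant vanishes.  The result is a second order
    difference equation for \<open>\<beta>\<close> alone (\<open>discrete_equation\<close>),
    \<open>\<beta>\<^sub>n R\<^sub>n R\<^sub>n\<^sub>-\<^sub>1 = (n - 2 t \<beta>\<^sub>n) (n + 2 \<alpha> - 2 t \<beta>\<^sub>n)\<close> where
    \<open>R\<^sub>n = 2 n + 1 + 2 \<alpha> - 2 t (\<beta>\<^sub>n + \<beta>\<^sub>n\<^sub>+\<^sub>1)\<close>.

  Solve this equation for the first factor \<open>\<beta>\<^sub>n\<close> and divide numerator and denominator by \<open>n\<^sup>2\<close>: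
  then every \<open>\<beta>\<close> on the right-hand side carries a factor \<open>1/n\<close>.  Hence an expansion of \<open>\<beta>\<close> with
  error \<open>O(n^(-N))\<close> yields one with error \<open>O(n^(-N-1))\<close>, and the induction starts from
  \<open>0 < \<beta>\<^sub>n \<le> 1\<close>.  So \<open>\<beta>\<close>, and with it the subleading coefficient, has a full asymptotic
  expansion in powers of \<open>1/n\<close>.  Since asymptotic coefficients are unique, the difference equation
  turns into an equation between formal power series, from which the coefficients are read off
  one after the other.
\<close>

section \<open>Integration against the weight\<close>

definition weighted_integral :: "real \<Rightarrow> real \<Rightarrow> real poly \<Rightarrow> real" where
  "weighted_integral \<alpha> t f = (LINT x:{-1..1}|lborel. poly f x * jacobi_weight \<alpha> t x)"

lemma jacobi_weight_measurable [measurable]: "jacobi_weight \<alpha> t \<in> borel_measurable borel"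
  unfolding jacobi_weight_def by measurable

lemma jacobi_weight_nonneg: "jacobi_weight \<alpha> t x \<ge> 0"
  by (simp add: jacobi_weight_def)

lemma poly_measurable [measurable]: "poly (f :: real poly) \<in> borel_measurable borel"
  by (intro borel_measurable_continuous_onI continuous_intros)

text \<open>The singularities at the endpoints are integrable because \<open>(1 - x)^\<alpha>\<close> has the antiderivative
  \<open>- (1 - x)^(\<alpha> + 1) / (\<alpha> + 1)\<close>, which is continuous up to \<open>x = 1\<close> for \<open>\<alpha> > -1\<close>.\<close>

lemma endpoint_powr_integrable:
  fixes \<alpha> :: real
  assumes "\<alpha> > -1"
  shows "set_integrable lborel {-1..1} (\<lambda>x. (1 - x) powr \<alpha>)"
    and "set_integrable lborel {-1..1} (\<lambda>x. (1 + x) powr \<alpha>)"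
proof -
  define F where "F x = - ((1 - x) powr (\<alpha> + 1)) / (\<alpha> + 1)" for x :: real
  have "((\<lambda>x. (1 - x) powr \<alpha>) has_integral F 1 - F (-1)) {-1..1}"
  proof (rule fundamental_theorem_of_calculus_interior)
    show "continuous_on {-1..1} F"
      unfolding F_def using assms by (intro continuous_intros continuous_on_powr') auto
  next
    fix x :: real assume x: "x \<in> {-1<..<1}"
    have "((\<lambda>x. (1 - x) powr (\<alpha> + 1)) has_real_derivative - ((\<alpha> + 1) * (1 - x) powr \<alpha>)) (at x)"
      using x by (auto intro!: derivative_eq_intros)
    from DERIV_cdivide[OF DERIV_minus[OF this], of "\<alpha> + 1"]
    have "(F has_real_derivative (1 - x) powr \<alpha>) (at x)"
      unfolding F_def using assms by simp
    then show "(F has_vector_derivative (1 - x) powr \<alpha>) (at x)"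
      by (simp add: has_real_derivative_iff_has_vector_derivative)
  qed simp
  then have "(\<lambda>x. (1 - x) powr \<alpha>) absolutely_integrable_on {-1..1}"
    by (intro nonnegative_absolutely_integrable_1) (auto simp: integrable_on_def)
  then show 1: "set_integrable lborel {-1..1} (\<lambda>x. (1 - x) powr \<alpha>)"
    unfolding set_integrable_def by (subst (asm) integrable_completion) auto
  have eq: "indicator {-1..1} (- x) = (indicator {-1..1} x :: real)" for x :: real
    by (auto simp: indicator_def)
  show "set_integrable lborel {-1..1} (\<lambda>x. (1 + x) powr \<alpha>)"
    using lborel_integrable_real_affine[OF 1[unfolded set_integrable_def], of "-1" 0]
    unfolding set_integrable_def by (simp add: eq)
qed

text \<open>For negative \<open>\<alpha>\<close> the factor whose base is at least 1 is itself at most 1, so the product is bounded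
  by the other factor; adding all the candidates avoids a case distinction later.\<close>

lemma powr_product_bound:
  fixes \<alpha> x :: real
  assumes "x \<in> {-1..1}"
  shows "(1 - x\<^sup>2) powr \<alpha> \<le> 1 + (1 - x) powr \<alpha> + (1 + x) powr \<alpha>"
proof -
  have split: "(1 - x\<^sup>2) powr \<alpha> = (1 - x) powr \<alpha> * (1 + x) powr \<alpha>"
    using assms by (subst powr_mult[symmetric]) (auto simp: power2_eq_square algebra_simps)
  show ?thesis
  proof (cases "\<alpha> \<ge> 0")
    case True
    have "(1 - x\<^sup>2) powr \<alpha> \<le> 1 powr \<alpha>"
      using True assms by (intro powr_mono2) (auto simp: abs_square_le_1 abs_le_iff)
    then show ?thesis by simp (smt (verit) powr_ge_zero)
  next
    case False
    have le_1: "y powr \<alpha> \<le> 1" if "y \<ge> 1" for y :: real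
      using that False powr_mono2'[of "-\<alpha>" 1 y] by (smt (verit) powr_mono2' powr_one_eq_one)
    have "(1 - x\<^sup>2) powr \<alpha> \<le> (1 - x) powr \<alpha> \<or> (1 - x\<^sup>2) powr \<alpha> \<le> (1 + x) powr \<alpha>"
    proof (cases "x \<ge> 0")
      case True
      then show ?thesis unfolding split using le_1[of "1 + x"] by (simp add: mult_left_le)
    next
      case False
      then show ?thesis unfolding split using le_1[of "1 - x"] by (simp add: mult_left_le_one_le)
    qed
    then show ?thesis by (smt (verit) powr_ge_zero)
  qed
qed

lemma jacobi_weight_integrable:
  assumes "\<alpha> > -1"
  shows "set_integrable lborel {-1..1} (jacobi_weight \<alpha> t)"
proof (rule set_integrable_bound)
  show "set_integrable lborel {-1..1} (\<lambda>x. exp \<bar>t\<bar> * (1 + (1 - x) powr \<alpha> + (1 + x) powr \<alpha>))"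
    by (intro set_integrable_mult_right set_integral_add endpoint_powr_integrable assms)
       (simp add: set_integrable_def)
  show "set_borel_measurable lborel {-1..1} (jacobi_weight \<alpha> t)"
    unfolding set_borel_measurable_def by measurable
  show "AE x in lborel. x \<in> {-1..1} \<longrightarrow> norm (jacobi_weight \<alpha> t x)
      \<le> norm (exp \<bar>t\<bar> * (1 + (1 - x) powr \<alpha> + (1 + x) powr \<alpha>))"
  proof (rule AE_I2, rule impI)
    fix x :: real assume x: "x \<in> {-1..1}"
    have "x\<^sup>2 \<le> 1"
      using x by (auto simp: abs_square_le_1 abs_le_iff)
    then have "\<bar>t\<bar> * x\<^sup>2 \<le> \<bar>t\<bar>"
      by (simp add: mult_left_le)
    moreover have "- t * x\<^sup>2 \<le> \<bar>t\<bar> * x\<^sup>2"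
      by (rule mult_right_mono) auto
    ultimately have "exp (- t * x\<^sup>2) \<le> exp \<bar>t\<bar>"
      by simp
    then have "jacobi_weight \<alpha> t x \<le> (1 + (1 - x) powr \<alpha> + (1 + x) powr \<alpha>) * exp \<bar>t\<bar>"
      unfolding jacobi_weight_def by (intro mult_mono powr_product_bound x) auto
    then show "norm (jacobi_weight \<alpha> t x) \<le> norm (exp \<bar>t\<bar> * (1 + (1 - x) powr \<alpha> + (1 + x) powr \<alpha>))"
      using jacobi_weight_nonneg[of \<alpha> t x] by (simp add: mult.commute)
  qed
qed

lemma weighted_poly_integrable:
  assumes "\<alpha> > -1"
  shows "set_integrable lborel {-1..1} (\<lambda>x. poly f x * jacobi_weight \<alpha> t x)"
proof -
  have "compact (poly f ` {-1..1})"
    by (intro compact_continuous_image continuous_intros) auto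
  then obtain B where B: "\<forall>x\<in>{-1..1}. \<bar>poly f x\<bar> \<le> B"
    by (auto dest!: compact_imp_bounded simp: bounded_iff)
  show ?thesis
  proof (rule set_integrable_bound)
    show "set_integrable lborel {-1..1} (\<lambda>x. B * jacobi_weight \<alpha> t x)"
      by (intro set_integrable_mult_right jacobi_weight_integrable assms)
    show "set_borel_measurable lborel {-1..1} (\<lambda>x. poly f x * jacobi_weight \<alpha> t x)"
      unfolding set_borel_measurable_def by measurable
    show "AE x in lborel. x \<in> {-1..1} \<longrightarrow>
        norm (poly f x * jacobi_weight \<alpha> t x) \<le> norm (B * jacobi_weight \<alpha> t x)"
      using B by (intro AE_I2) (fastforce simp: abs_mult intro: mult_right_mono)
  qed
qed

lemma weighted_integral_add:
  "\<alpha> > -1 \<Longrightarrow> weighted_integral \<alpha> t (p + q) = weighted_integral \<alpha> t p + weighted_integral \<alpha> t q"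
  by (simp add: weighted_integral_def distrib_right set_integral_add weighted_poly_integrable)

lemma weighted_integral_smult: "weighted_integral \<alpha> t (smult c p) = c * weighted_integral \<alpha> t p"
  by (simp add: weighted_integral_def mult.assoc)

lemma weighted_integral_reflect:
  "weighted_integral \<alpha> t (pcompose p [:0, - 1:]) = weighted_integral \<alpha> t p"
proof -
  have eq: "indicator {-1..1} (- x) = (indicator {-1..1} x :: real)" for x :: real
    by (auto simp: indicator_def)
  show ?thesis
    unfolding weighted_integral_def set_lebesgue_integral_def
    by (subst (2) lborel_integral_real_affine[of "-1" _ 0])
       (simp_all add: eq poly_pcompose jacobi_weight_def)
qed

text \<open>Multiplication by \<open>x\<close> is a contraction because \<open>\<bar>x\<bar> \<le> 1\<close> on the support; this will bound the
  recurrence coefficients.\<close>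

lemma weighted_integral_contract:
  assumes "\<alpha> > -1"
  shows "weighted_integral \<alpha> t (([:0, 1:] * p) * ([:0, 1:] * p)) \<le> weighted_integral \<alpha> t (p * p)"
  unfolding weighted_integral_def
proof (intro set_integral_mono weighted_poly_integrable assms)
  fix x :: real assume "x \<in> {-1..1}"
  then have "x\<^sup>2 \<le> 1"
    by (auto simp: abs_square_le_1 abs_le_iff)
  then have "x\<^sup>2 * (poly p x * poly p x) \<le> 1 * (poly p x * poly p x)"
    by (intro mult_right_mono) auto
  then show "poly (([:0, 1:] * p) * ([:0, 1:] * p)) x * jacobi_weight \<alpha> t x \<le> poly (p * p) x * jacobi_weight \<alpha> t x"
    by (intro mult_right_mono jacobi_weight_nonneg) (simp add: power2_eq_square algebra_simps)
qed

lemma weighted_integral_square_pos: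
  assumes "\<alpha> > -1" and "p \<noteq> 0"
  shows "weighted_integral \<alpha> t (p * p) > 0"
proof -
  define g where "g x = indicator {-1..1} x *\<^sub>R (poly (p * p) x * jacobi_weight \<alpha> t x)" for x :: real
  have int: "integrable lborel g"
    using weighted_poly_integrable[OF assms(1), of "p * p" t] unfolding set_integrable_def g_def .
  have nonneg: "g x \<ge> 0" for x
    by (simp add: g_def jacobi_weight_nonneg)
  have L: "weighted_integral \<alpha> t (p * p) = integral\<^sup>L lborel g"
    unfolding weighted_integral_def set_lebesgue_integral_def g_def ..
  have "integral\<^sup>L lborel g \<noteq> 0"
  proof
    assume "integral\<^sup>L lborel g = 0"
    then have "AE x in lborel. g x = 0"
      using integral_nonneg_eq_0_iff_AE[OF int] nonneg by simp
    moreover have "AE x in lborel. x \<notin> {x. poly p x = 0}"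
      by (intro AE_not_in finite_imp_null_set_lborel poly_roots_finite assms)
    \<comment> \<open>Where the weight is positive, only the finitely many roots of the polynomial can make the integrand vanish.\<close>
    ultimately have "AE x in lborel. x \<notin> {-1<..<(1::real)}"
    proof eventually_elim
      case (elim x)
      show ?case
      proof
        assume x: "x \<in> {-1<..<1}"
        then have "1 - x\<^sup>2 > 0"
          by (auto simp: abs_square_less_1 abs_less_iff)
        with x elim show False
          by (auto simp: g_def jacobi_weight_def)
      qed
    qed
    then have "emeasure lborel {x \<in> space lborel. \<not> x \<notin> {-1<..<(1::real)}} = 0"
      by (subst (asm) AE_iff_measurable[OF _ refl]) auto
    moreover have "{x \<in> space lborel. \<not> x \<notin> {-1<..<(1::real)}} = {-1<..<1}"
      by auto
    ultimately have "emeasure lborel {-1<..<(1::real)} = 0"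
      by (simp only:)
    then show False
      using emeasure_lborel_Ioo[of "-1" "1::real"] by simp
  qed
  moreover have "integral\<^sup>L lborel g \<ge> 0"
    by (intro integral_nonneg_AE AE_I2 nonneg)
  ultimately show ?thesis
    unfolding L by simp
qed

text \<open>The integrand is the derivative of \<open>\<sigma> w f\<close>, and \<open>\<sigma> w = (1 - x\<^sup>2)^(\<alpha> + 1) exp (- t x\<^sup>2)\<close> is continuous
  on \<open>[-1,1]\<close> and zero at the endpoints because \<open>\<alpha> + 1 > 0\<close>.\<close>

lemma weighted_integral_pearson:
  assumes "\<alpha> > -1"
  shows "weighted_integral \<alpha> t ([:1, 0, - 1:] * pderiv f + [:0, - 2 * (1 + \<alpha> + t), 0, 2 * t:] * f) = 0"
proof -
  let ?g = "[:1, 0, - 1:] * pderiv f + [:0, - 2 * (1 + \<alpha> + t), 0, 2 * t:] * f"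
  define F where "F x = (1 - x\<^sup>2) powr (\<alpha> + 1) * exp (- t * x\<^sup>2) * poly f x" for x :: real
  have "((\<lambda>x. poly ?g x * jacobi_weight \<alpha> t x) has_integral F 1 - F (-1)) {-1..1}"
  proof (rule fundamental_theorem_of_calculus_interior)
    have "1 - x\<^sup>2 \<ge> 0" if "x \<in> {-1..1}" for x :: real
      using that by (auto simp: abs_square_le_1 abs_le_iff)
    then show "continuous_on {-1..1} F"
      unfolding F_def using assms by (intro continuous_intros continuous_on_powr') auto
  next
    fix x :: real assume "x \<in> {-1<..<1}"
    then have x: "1 - x\<^sup>2 > 0"
      by (auto simp: abs_square_less_1 abs_less_iff)
    have "(F has_real_derivative ((\<alpha> + 1) * (1 - x\<^sup>2) powr \<alpha> * (- 2 * x)) * exp (- t * x\<^sup>2) * poly f x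
        + (1 - x\<^sup>2) powr (\<alpha> + 1) * (exp (- t * x\<^sup>2) * (- 2 * t * x)) * poly f x
        + (1 - x\<^sup>2) powr (\<alpha> + 1) * exp (- t * x\<^sup>2) * poly (pderiv f) x) (at x)"
      unfolding F_def using x by (auto intro!: derivative_eq_intros simp: algebra_simps)
    moreover have "(1 - x\<^sup>2) powr (\<alpha> + 1) = (1 - x\<^sup>2) * (1 - x\<^sup>2) powr \<alpha>"
      using x by (simp add: powr_add mult.commute)
    ultimately have "(F has_real_derivative ((\<alpha> + 1) * (1 - x\<^sup>2) powr \<alpha> * (- 2 * x)) * exp (- t * x\<^sup>2) * poly f x
        + ((1 - x\<^sup>2) * (1 - x\<^sup>2) powr \<alpha>) * (exp (- t * x\<^sup>2) * (- 2 * t * x)) * poly f x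
        + ((1 - x\<^sup>2) * (1 - x\<^sup>2) powr \<alpha>) * exp (- t * x\<^sup>2) * poly (pderiv f) x) (at x)"
      by (simp only:)
    then have "(F has_real_derivative poly ?g x * jacobi_weight \<alpha> t x) (at x)"
      by (rule DERIV_cong) (simp add: jacobi_weight_def, algebra)
    then show "(F has_vector_derivative poly ?g x * jacobi_weight \<alpha> t x) (at x)"
      by (simp add: has_real_derivative_iff_has_vector_derivative)
  qed simp
  moreover have "F 1 = 0" "F (-1) = 0"
    by (simp_all add: F_def)
  ultimately show ?thesis
    unfolding weighted_integral_def
    using set_borel_integral_eq_integral(2)[OF weighted_poly_integrable[OF assms, of ?g t]]
    by (simp add: integral_unique)
qed

section \<open>Even semiclassical functionals and their orthogonal polynomials\<close>

text \<open>The properties of the weight that the algebra uses: a positive definite even functional with a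
  Pearson equation for \<open>\<sigma> = 1 - x\<^sup>2\<close>, for which multiplication by \<open>x\<close> is a contraction, together with
  its monic orthogonal polynomials.\<close>

locale even_semiclassical_functional =
  fixes L :: "real poly \<Rightarrow> real" and \<alpha> t :: real and P :: "nat \<Rightarrow> real poly"
  assumes L_add: "L (p + q) = L p + L q"
    and L_smult: "L (smult c p) = c * L p"
    and L_pos: "p \<noteq> 0 \<Longrightarrow> L (p * p) > 0"
    and L_reflect: "L (pcompose p [:0, - 1:]) = L p"
    and L_contract: "L (([:0, 1:] * p) * ([:0, 1:] * p)) \<le> L (p * p)"
    and pearson: "L ([:1, 0, - 1:] * pderiv p + [:0, - 2 * (1 + \<alpha> + t), 0, 2 * t:] * p) = 0"
    and degree_P: "degree (P n) = n"
    and monic_P: "coeff (P n) n = 1"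
    and orth_P: "m \<noteq> n \<Longrightarrow> L (P m * P n) = 0"
begin

abbreviation x :: "real poly" where "x \<equiv> [:0, 1:]"

abbreviation \<sigma> :: "real poly" where "\<sigma> \<equiv> [:1, 0, - 1:]"

abbreviation \<tau> :: "real poly" where "\<tau> \<equiv> [:0, - 2 * (1 + \<alpha> + t), 0, 2 * t:]"

definition h :: "nat \<Rightarrow> real" where "h n = L (P n * P n)"

text \<open>The recurrence coefficients.  Truncated subtraction makes \<open>\<beta> 0 = 1\<close>; the recurrence starts
  with \<open>\<beta> 1\<close>.\<close>

definition \<beta> :: "nat \<Rightarrow> real" where "\<beta> n = h n / h (n - 1)"

lemma L_0 [simp]: "L 0 = 0"
  using L_smult[of 0 0] by simp

lemma L_minus: "L (- p) = - L p"
  using L_smult[of "- 1" p] by simp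

lemma L_diff: "L (p - q) = L p - L q"
  using L_add[of p "- q"] by (simp add: L_minus)

lemmas L_linear = L_add L_diff L_minus L_smult

lemma P_nonzero: "P n \<noteq> 0"
  using monic_P[of n] by auto

lemma h_pos: "h n > 0"
  by (simp add: h_def L_pos P_nonzero)

lemma h_nonzero [simp]: "h n \<noteq> 0"
  using h_pos[of n] by simp

lemma coeff_P_beyond: "i > n \<Longrightarrow> coeff (P n) i = 0"
  by (simp add: coeff_eq_0 degree_P)

lemma h_Suc: "h (Suc n) = \<beta> (Suc n) * h n"
  by (simp add: \<beta>_def)

lemma \<beta>_pos: "\<beta> n > 0"
  by (simp add: \<beta>_def h_pos)

text \<open>Peeling off leading terms writes \<open>g\<close> as a combination of the first \<open>k\<close> of the monic polynomials.\<close>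

lemma orthogonal_to_span:
  assumes "\<And>i. i < k \<Longrightarrow> L (f * P i) = 0" and "\<And>i. i \<ge> k \<Longrightarrow> coeff g i = 0"
  shows "L (f * g) = 0"
  using assms
proof (induction k arbitrary: g)
  case 0
  then have "g = 0" by (simp add: poly_eq_iff)
  then show ?case by simp
next
  case (Suc k)
  define r where "r = g - smult (coeff g k) (P k)"
  have "coeff r i = 0" if "i \<ge> k" for i
    using that Suc.prems(2)[of i] by (cases "i = k") (auto simp: r_def monic_P coeff_P_beyond)
  with Suc have "L (f * r) = 0" by simp
  moreover have "f * g = f * r + smult (coeff g k) (f * P k)"
    by (simp add: r_def algebra_simps)
  ultimately show ?case
    using Suc.prems(1)[of k] by (simp add: L_linear)
qed

lemma orthogonal_to_lower_degree:
  assumes "\<And>i. i \<ge> n \<Longrightarrow> coeff g i = 0"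
  shows "L (g * P n) = 0"
  using orthogonal_to_span[of n "P n" g] assms orth_P[of n] by (simp add: mult.commute)

text \<open>Subtracting the multiple of \<open>P n\<close> with the same top coefficient leaves a polynomial of lower degree.\<close>

lemma project_to_P:
  assumes "\<And>i. i > n \<Longrightarrow> coeff g i = 0"
  shows "L (g * P n) = coeff g n * h n"
proof -
  have "L ((g - smult (coeff g n) (P n)) * P n) = 0"
  proof (rule orthogonal_to_lower_degree)
    fix i assume "i \<ge> n"
    then show "coeff (g - smult (coeff g n) (P n)) i = 0"
      using assms[of i] by (cases "i = n") (auto simp: monic_P coeff_P_beyond)
  qed
  then show ?thesis
    by (simp add: left_diff_distrib L_linear h_def)
qed

text \<open>The principle behind every polynomial identity below: to show that the two sides agree, bound the
  degree of the difference and test it against the \<open>P i\<close>.\<close>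

lemma zero_if_orthogonal:
  assumes "\<And>i. i \<ge> k \<Longrightarrow> coeff f i = 0" and "\<And>i. i < k \<Longrightarrow> L (f * P i) = 0"
  shows "f = 0"
proof -
  have "L (f * f) = 0"
    by (rule orthogonal_to_span[of k]) (use assms in auto)
  then show ?thesis
    using L_pos[of f] by auto
qed

lemma L_odd: "pcompose p [:0, - 1:] = - p \<Longrightarrow> L p = 0"
  using L_reflect[of p] by (simp add: L_minus)

text \<open>The reflected polynomial \<open>(- 1)^n P n (- x)\<close> is again monic and orthogonal to all lower degrees, by
  evenness of \<open>L\<close>.\<close>

lemma P_reflect: "pcompose (P n) [:0, - 1:] = smult ((- 1) ^ n) (P n)"
proof -
  define f where "f = pcompose (P n) [:0, - 1:] - smult ((- 1) ^ n) (P n)"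
  have "f = 0"
  proof (rule zero_if_orthogonal[of n])
    show "coeff f i = 0" if "i \<ge> n" for i
      using that by (cases "i = n") (auto simp: f_def coeff_pcompose_linear coeff_P_beyond)
  next
    fix i assume i: "i < n"
    have "L (pcompose (P n) [:0, - 1:] * P i) = L (P n * pcompose (P i) [:0, - 1:])"
      using L_reflect[of "P n * pcompose (P i) [:0, - 1:]"]
      by (simp add: pcompose_mult pcompose_pCons flip: pcompose_assoc)
    also have "\<dots> = L (pcompose (P i) [:0, - 1:] * P n)"
      by (simp add: mult.commute)
    also have "\<dots> = 0"
      by (rule orthogonal_to_lower_degree) (use i in \<open>simp add: coeff_pcompose_linear coeff_P_beyond\<close>)
    finally show "L (f * P i) = 0"
      using i orth_P[of n i] by (simp add: f_def left_diff_distrib L_linear)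
  qed
  then show ?thesis by (simp add: f_def)
qed

lemma L_x_square: "L (x * P n * P n) = 0"
  by (rule L_odd) (simp add: pcompose_mult P_reflect pcompose_pCons flip: power_add)

lemma coeff_x_mult: "coeff (x * p) i = (if i = 0 then 0 else coeff p (i - 1))"
  by (cases i) auto

lemma recurrence: "x * P (Suc n) = P (Suc (Suc n)) + smult (\<beta> (Suc n)) (P n)"
proof -
  define f where "f = x * P (Suc n) - P (Suc (Suc n)) - smult (\<beta> (Suc n)) (P n)"
  have "f = 0"
  proof (rule zero_if_orthogonal[of "Suc (Suc n)"])
    show "coeff f i = 0" if "i \<ge> Suc (Suc n)" for i
      using that by (cases "i = Suc (Suc n)")
        (auto simp: f_def coeff_x_mult coeff_P_beyond monic_P simp del: mult_pCons_left)
  next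
    fix i assume i: "i < Suc (Suc n)"
    have f: "L (f * P i) = L (x * P (Suc n) * P i) - \<beta> (Suc n) * L (P n * P i)"
      using i by (simp add: f_def left_diff_distrib L_linear orth_P)
    have swap: "L (x * P (Suc n) * P i) = L ((x * P i) * P (Suc n))"
      by (simp only: ac_simps)
    consider "i < n" | "i = n" | "i = Suc n"
      using i by linarith
    then show "L (f * P i) = 0"
    proof cases
      case 1
      have "L ((x * P i) * P (Suc n)) = 0"
        by (rule orthogonal_to_lower_degree)
           (use 1 in \<open>simp add: coeff_x_mult coeff_P_beyond del: mult_pCons_left\<close>)
      with 1 show ?thesis unfolding f swap by (simp add: orth_P)
    next
      case 2
      have "L ((x * P n) * P (Suc n)) = coeff (x * P n) (Suc n) * h (Suc n)"
        by (rule project_to_P) (simp add: coeff_x_mult coeff_P_beyond del: mult_pCons_left)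
      with 2 show ?thesis unfolding f swap
        by (simp add: coeff_x_mult monic_P h_Suc flip: h_def del: mult_pCons_left)
    next
      case 3
      then show ?thesis unfolding f using L_x_square[of "Suc n"] by (simp add: orth_P)
    qed
  qed
  then show ?thesis by (simp add: f_def)
qed

lemma L_P_P:
  "L (P m * P n) = (if m = n then h n else 0)"
  by (simp add: h_def orth_P)

text \<open>The squared norm of \<open>x P n = P (n + 1) + \<beta> n P (n - 1)\<close> is at least \<open>h (n + 1)\<close> and at most \<open>h n\<close>.\<close>

lemma \<beta>_le_1: "\<beta> (Suc (Suc n)) \<le> 1"
proof -
  have "L ((x * P (Suc n)) * (x * P (Suc n))) = h (Suc (Suc n)) + (\<beta> (Suc n))\<^sup>2 * h n"
    unfolding recurrence by (simp add: L_P_P L_linear distrib_left distrib_right power2_eq_square)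
  moreover have "L ((x * P (Suc n)) * (x * P (Suc n))) \<le> h (Suc n)"
    unfolding h_def by (rule L_contract)
  moreover have "(\<beta> (Suc n))\<^sup>2 * h n \<ge> 0"
    using h_pos[of n] by simp
  ultimately show ?thesis
    using h_pos[of "Suc n"] by (simp add: \<beta>_def divide_le_eq)
qed

text \<open>The Pearson equation applied to the product \<open>p * q\<close>.\<close>

lemma integration_by_parts:
  "L (\<sigma> * pderiv p * q) = - L ((\<sigma> * pderiv q + \<tau> * q) * p)"
proof -
  have "\<sigma> * pderiv (p * q) + \<tau> * (p * q) = \<sigma> * pderiv p * q + (\<sigma> * pderiv q + \<tau> * q) * p"
    unfolding pderiv_mult by algebra
  then show ?thesis
    using pearson[of "p * q"] L_add[of "\<sigma> * pderiv p * q" "(\<sigma> * pderiv q + \<tau> * q) * p"] by simp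
qed

lemma coeff_\<sigma>_mult: "coeff (\<sigma> * p) i = coeff p i - (if i < 2 then 0 else coeff p (i - 2))"
  by (simp add: coeff_pCons numeral_2_eq_2 split: nat.split)

lemma coeff_\<tau>_mult: "coeff ([:0, a, 0, b:] * p) i =
    a * (if i < 1 then 0 else coeff p (i - 1)) + b * (if i < 3 then 0 else coeff p (i - 3))"
  by (simp add: coeff_pCons numeral_3_eq_3 split: nat.split)

lemma L_\<tau>_same_parity:
  assumes "even (m + n)"
  shows "L (\<tau> * P m * P n) = 0"
proof (rule L_odd)
  have "pcompose \<tau> [:0, - 1:] = - \<tau>"
    by (simp add: pcompose_pCons)
  moreover have "(- 1) ^ n * (- 1) ^ m = (1 :: real)"
    using assms by (simp add: add.commute flip: power_add)
  ultimately show "pcompose (\<tau> * P m * P n) [:0, - 1:] = - (\<tau> * P m * P n)"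
    by (simp only: pcompose_mult P_reflect mult_smult_left mult_smult_right smult_smult
        smult_1_left mult_minus_left)
qed

text \<open>Three applications of the recurrence give the matrix entry of \<open>x\<^sup>3\<close> between neighbours; it is the
  source of the sum of three consecutive \<open>\<beta>\<close>s in all later formulas.\<close>

lemma L_\<tau>_neighbours:
  "L (\<tau> * P (k + 2) * P (k + 3)) =
     h (k + 3) * (2 * t * (\<beta> (k + 2) + \<beta> (k + 3) + \<beta> (k + 4)) - 2 * (1 + \<alpha> + t))"
proof -
  have r1: "x * P (k + 1) = P (k + 2) + smult (\<beta> (k + 1)) (P k)"
    and r2: "x * P (k + 2) = P (k + 3) + smult (\<beta> (k + 2)) (P (k + 1))"
    and r3: "x * P (k + 3) = P (k + 4) + smult (\<beta> (k + 3)) (P (k + 2))"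
    using recurrence[of k] recurrence[of "k + 1"] recurrence[of "k + 2"] by (simp_all add: eval_nat_numeral)
  have "x * (x * P (k + 2)) = P (k + 4) + smult (\<beta> (k + 3) + \<beta> (k + 2)) (P (k + 2))
      + smult (\<beta> (k + 2) * \<beta> (k + 1)) (P k)"
    unfolding r2 distrib_left mult_smult_right r1 r3 by (simp add: smult_add_left smult_add_right)
  then have "L ((x * (x * P (k + 2))) * (x * P (k + 3))) = h (k + 4) + (\<beta> (k + 3) + \<beta> (k + 2)) * \<beta> (k + 3) * h (k + 2)"
    unfolding r3 by (simp add: distrib_left distrib_right L_linear L_P_P)
  also have "\<dots> = h (k + 3) * (\<beta> (k + 2) + \<beta> (k + 3) + \<beta> (k + 4))"
    using h_Suc[of "k + 2"] h_Suc[of "k + 3"] by (simp add: eval_nat_numeral algebra_simps)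
  finally have cube: "L ((x * (x * P (k + 2))) * (x * P (k + 3))) = \<dots>" .
  have lin: "L (x * P (k + 2) * P (k + 3)) = h (k + 3)"
    unfolding r2 by (simp add: distrib_left distrib_right L_linear L_P_P)
  have distrib: "(smult a z + smult b (z * z * z)) * p * q = smult a (z * p * q) + smult b ((z * (z * p)) * (z * q))"
    for a b and z p q :: "real poly"
    by (simp add: algebra_simps)
  have "\<tau> = smult (- 2 * (1 + \<alpha> + t)) x + smult (2 * t) (x * x * x)"
    by simp
  then have "\<tau> * P (k + 2) * P (k + 3) = smult (- 2 * (1 + \<alpha> + t)) (x * P (k + 2) * P (k + 3))
      + smult (2 * t) ((x * (x * P (k + 2))) * (x * P (k + 3)))"
    by (simp only: distrib)
  then show ?thesis
    by (simp only: L_linear cube lin) (simp add: algebra_simps)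
qed

text \<open>The coefficient of \<open>P (k + 2)\<close> in the expansion of \<open>\<sigma> P'\<close> for \<open>P (k + 3)\<close>.\<close>

definition structure_coeff :: "nat \<Rightarrow> real" where
  "structure_coeff k = \<beta> (k + 3) * (real k + 2 + 2 * (1 + \<alpha> + t) - 2 * t * (\<beta> (k + 2) + \<beta> (k + 3) + \<beta> (k + 4)))"

text \<open>By parts, pairing \<open>\<sigma> P'\<close> with \<open>P i\<close> amounts to pairing \<open>P (k + 3)\<close> with a polynomial of degree at
  most \<open>i + 3\<close>, so the component along \<open>P i\<close> vanishes for \<open>i < k\<close>; the components along \<open>P (k + 1)\<close> and \<open>P (k + 3)\<close> vanish by parity,
  and the other three are computed.\<close>

lemma structure_relation:
  "\<sigma> * pderiv (P (k + 3)) = smult (- real (k + 3)) (P (k + 4)) + smult (structure_coeff k) (P (k + 2))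
     - smult (2 * t * \<beta> (k + 3) * \<beta> (k + 2) * \<beta> (k + 1)) (P k)"
proof -
  define d where "d = 2 * t * \<beta> (k + 3) * \<beta> (k + 2) * \<beta> (k + 1)"
  define g where "g = \<sigma> * pderiv (P (k + 3)) + smult (real (k + 3)) (P (k + 4)) - smult (structure_coeff k) (P (k + 2))
     + smult d (P k)"
  have h3: "h (k + 3) = \<beta> (k + 3) * h (k + 2)" "h (k + 3) = \<beta> (k + 3) * \<beta> (k + 2) * \<beta> (k + 1) * h k"
    using h_Suc[of "k + 2"] h_Suc[of "k + 1"] h_Suc[of k] by (simp_all add: eval_nat_numeral)
  have "g = 0"
  proof (rule zero_if_orthogonal[of "k + 4"])
    show "coeff g i = 0" if "i \<ge> k + 4" for i
    proof (cases "i = k + 4")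
      case True
      then show ?thesis
        using monic_P[of "k + 4"] monic_P[of "k + 3"]
        by (simp add: g_def coeff_\<sigma>_mult coeff_pderiv coeff_P_beyond eval_nat_numeral
             del: mult_pCons_left)
    next
      case False
      with that show ?thesis
        by (simp add: g_def coeff_\<sigma>_mult coeff_pderiv coeff_P_beyond del: mult_pCons_left)
    qed
  next
    fix i assume i: "i < k + 4"
    have g: "L (g * P i) = L (\<sigma> * pderiv (P (k + 3)) * P i) - structure_coeff k * L (P (k + 2) * P i) + d * L (P k * P i)"
      using i by (simp add: g_def distrib_right left_diff_distrib L_linear L_P_P del: mult_pCons_left)
    note parts = integration_by_parts[of "P (k + 3)" "P i"]
    consider "i < k" | "i = k" | "i = k + 1" | "i = k + 2" | "i = k + 3"
      using i by linarith
    then show "L (g * P i) = 0"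
    proof cases
      case 1
      have "L ((\<sigma> * pderiv (P i) + \<tau> * P i) * P (k + 3)) = 0"
        by (rule orthogonal_to_lower_degree)
          (use 1 in \<open>simp add: coeff_\<sigma>_mult coeff_\<tau>_mult coeff_pderiv coeff_P_beyond del: mult_pCons_left\<close>)
      with 1 show ?thesis unfolding g parts by (simp add: L_P_P)
    next
      case 2
      have "L ((\<sigma> * pderiv (P i) + \<tau> * P i) * P (k + 3))
          = coeff (\<sigma> * pderiv (P i) + \<tau> * P i) (k + 3) * h (k + 3)"
        by (rule project_to_P)
          (use 2 in \<open>simp add: coeff_\<sigma>_mult coeff_\<tau>_mult coeff_pderiv coeff_P_beyond del: mult_pCons_left\<close>)
      also have "\<dots> = 2 * t * h (k + 3)"
        using 2 by (simp add: coeff_\<sigma>_mult coeff_\<tau>_mult coeff_pderiv coeff_P_beyond monic_P del: mult_pCons_left)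
      finally show ?thesis using 2 unfolding g parts by (simp add: L_P_P d_def h3(2))
    next
      case 3
      have "L (\<sigma> * pderiv (P i) * P (k + 3)) = 0"
        by (rule orthogonal_to_lower_degree)
          (use 3 in \<open>simp add: coeff_\<sigma>_mult coeff_pderiv coeff_P_beyond del: mult_pCons_left\<close>)
      moreover have "L (\<tau> * P i * P (k + 3)) = 0"
        by (rule L_\<tau>_same_parity) (use 3 in simp)
      ultimately show ?thesis using 3 unfolding g parts distrib_right[of _ _ "P (k + 3)"]
        by (simp add: L_linear L_P_P del: mult_pCons_left)
    next
      case 4
      have "L (\<sigma> * pderiv (P i) * P (k + 3)) = coeff (\<sigma> * pderiv (P i)) (k + 3) * h (k + 3)"
        by (rule project_to_P)
          (use 4 in \<open>simp add: coeff_\<sigma>_mult coeff_pderiv coeff_P_beyond del: mult_pCons_left\<close>)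
      also have "\<dots> = - real (k + 2) * h (k + 3)"
        using 4 monic_P[of "k + 2"]
        by (simp add: coeff_\<sigma>_mult coeff_pderiv coeff_P_beyond eval_nat_numeral del: mult_pCons_left)
      finally have \<sigma>_part: "L (\<sigma> * pderiv (P i) * P (k + 3)) = - real (k + 2) * h (k + 3)" .
      have "L ((\<sigma> * pderiv (P i) + \<tau> * P i) * P (k + 3)) = - structure_coeff k * h (k + 2)"
        unfolding distrib_right[of _ _ "P (k + 3)"] L_add \<sigma>_part
        unfolding 4 L_\<tau>_neighbours structure_coeff_def h3(1) by (simp add: algebra_simps)
      then show ?thesis unfolding g parts using 4 by (simp add: L_P_P)
    next
      case 5
      have "L (\<tau> * P i * P (k + 3)) = 0"
        by (rule L_\<tau>_same_parity) (use 5 in simp)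
      then show ?thesis using 5 parts unfolding g distrib_right[of _ _ "P (k + 3)"]
        by (simp add: L_linear L_P_P del: mult_pCons_left)
    qed
  qed
  then show ?thesis
    unfolding g_def d_def smult_minus_left by algebra
qed

text \<open>Compare coefficients of \<open>x^(k + 2)\<close> in the structure relation and in the recurrence; the second
  comparison eliminates the subleading coefficient of \<open>P (k + 4)\<close>.\<close>

lemma subleading_formula:
  "2 * coeff (P (k + 3)) (k + 1) = - real (k + 3)
     + \<beta> (k + 3) * (2 * real (k + 3) + 1 + 2 * \<alpha> + 2 * t - 2 * t * (\<beta> (k + 2) + \<beta> (k + 3) + \<beta> (k + 4)))"
proof -
  have "coeff (P (k + 3)) (k + 1) = coeff (P (k + 4)) (k + 2) + \<beta> (k + 3)"
    using arg_cong[OF recurrence[of "k + 2"], of "\<lambda>p. coeff p (k + 2)"] monic_P[of "k + 2"]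
    by (simp add: coeff_x_mult eval_nat_numeral del: mult_pCons_left)
  moreover have "real (k + 3) - real (k + 1) * coeff (P (k + 3)) (k + 1)
      = - real (k + 3) * coeff (P (k + 4)) (k + 2) + structure_coeff k"
    using arg_cong[OF structure_relation[of k], of "\<lambda>p. coeff p (k + 2)"] monic_P[of "k + 3"] monic_P[of "k + 2"]
    by (simp add: coeff_\<sigma>_mult coeff_pderiv coeff_P_beyond eval_nat_numeral del: mult_pCons_left)
  ultimately show ?thesis
    by (simp add: structure_coeff_def algebra_simps)
qed

text \<open>With \<open>A(x)\<close> the factor of \<open>\<beta> n P (n - 1)\<close> when the structure relation is rewritten in terms of \<open>P n\<close>
  and \<open>P (n - 1)\<close> only (a ladder operator), this is \<open>A(1)\<close>.\<close>

definition R :: "nat \<Rightarrow> real" where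
  "R n = 2 * real n + 1 + 2 * \<alpha> - 2 * t * (\<beta> n + \<beta> (n + 1))"

lemma value_recurrence: "poly (P (Suc n)) 1 = poly (P (Suc (Suc n))) 1 + \<beta> (Suc n) * poly (P n) 1"
  using arg_cong[OF recurrence[of n], of "\<lambda>p. poly p 1"] by simp

text \<open>The structure relation at the zero \<open>x = 1\<close> of \<open>\<sigma>\<close>, with the recurrence used to rewrite the values of
  \<open>P (k + 4)\<close> and \<open>P k\<close> through those of \<open>P (k + 3)\<close> and \<open>P (k + 2)\<close>.\<close>

lemma endpoint_relation:
  "(2 * t * \<beta> (k + 3) - real (k + 3)) * poly (P (k + 3)) 1 + \<beta> (k + 3) * R (k + 3) * poly (P (k + 2)) 1 = 0"
proof -
  define y0 y1 y2 y3 y4 where y: "y0 = poly (P k) 1" "y1 = poly (P (k + 1)) 1" "y2 = poly (P (k + 2)) 1"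
    "y3 = poly (P (k + 3)) 1" "y4 = poly (P (k + 4)) 1"
  have r: "\<beta> (k + 1) * y0 = y1 - y2" "\<beta> (k + 2) * y1 = y2 - y3" "y4 = y3 - \<beta> (k + 3) * y2"
    using value_recurrence[of k] value_recurrence[of "k + 1"] value_recurrence[of "k + 2"]
    by (simp_all add: y eval_nat_numeral)
  have "0 = - real (k + 3) * y4 + structure_coeff k * y2 - 2 * t * \<beta> (k + 3) * \<beta> (k + 2) * (\<beta> (k + 1) * y0)"
    using arg_cong[OF structure_relation[of k], of "\<lambda>p. poly p 1"] by (simp add: y algebra_simps)
  also have "\<dots> = - real (k + 3) * y4 + structure_coeff k * y2 - 2 * t * \<beta> (k + 3) * (\<beta> (k + 2) * y1 - \<beta> (k + 2) * y2)"
    unfolding r(1) by (simp add: algebra_simps)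
  also have "\<dots> = (2 * t * \<beta> (k + 3) - real (k + 3)) * y3 + \<beta> (k + 3) * R (k + 3) * y2"
    unfolding r(2) r(3) structure_coeff_def R_def by (simp add: algebra_simps)
  finally show ?thesis
    by (simp add: y)
qed

text \<open>Two consecutive zeros would propagate down the recurrence to \<open>P 0 = 1\<close>.\<close>

lemma values_not_both_zero: "poly (P n) 1 \<noteq> 0 \<or> poly (P (Suc n)) 1 \<noteq> 0"
proof (induction n)
  case 0
  have "P 0 = 1"
    using degree_P[of 0] monic_P[of 0] by (metis degree_0_id of_nat_1 one_poly_eq_simps(2) pCons_0_0)
  then show ?case by simp
next
  case (Suc n)
  then show ?case
    using value_recurrence[of n] \<beta>_pos[of "Suc n"] by auto
qed

text \<open>The endpoint relations for \<open>n\<close> and \<open>n - 1\<close> are two linear relations between \<open>P n (1)\<close> and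
  \<open>P (n - 1) (1)\<close>, which do not both vanish; the equation says that their determinant is zero.\<close>

theorem discrete_equation:
  assumes "n \<ge> 4"
  shows "\<beta> n * R n * R (n - 1) = (real n - 2 * t * \<beta> n) * (real n + 2 * \<alpha> - 2 * t * \<beta> n)"
proof -
  obtain k where n: "n = k + 4"
    using assms by (metis add.commute le_Suc_ex)
  define u v where "u = poly (P (k + 4)) 1" and "v = poly (P (k + 3)) 1"
  have 1: "(2 * t * \<beta> n - real n) * u + \<beta> n * R n * v = 0"
    using endpoint_relation[of "k + 1"] by (simp add: u_def v_def n eval_nat_numeral)
  have n1: "n - 1 = k + 3"
    by (simp add: n)
  have "\<beta> (k + 3) * poly (P (k + 2)) 1 = v - u"
    using value_recurrence[of "k + 2"] by (simp add: u_def v_def eval_nat_numeral)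
  with endpoint_relation[of k]
  have 2: "(2 * t * \<beta> (n - 1) - real (n - 1) + R (n - 1)) * v - R (n - 1) * u = 0"
    unfolding n1 v_def[symmetric] by algebra
  \<comment> \<open>The terms with \<open>\<beta> (n - 1)\<close> outside \<open>R\<close> cancel, which makes the right-hand side a function of \<open>\<beta> n\<close> alone.\<close>
  have e: "2 * t * \<beta> (n - 1) - real (n - 1) + R (n - 1) = real n + 2 * \<alpha> - 2 * t * \<beta> n"
    by (simp add: R_def n algebra_simps eval_nat_numeral)
  have "u \<noteq> 0 \<or> v \<noteq> 0"
    using values_not_both_zero[of "k + 3"] by (auto simp: u_def v_def eval_nat_numeral)
  moreover have "(\<beta> n * R n * R (n - 1) - (real n - 2 * t * \<beta> n) * (real n + 2 * \<alpha> - 2 * t * \<beta> n)) * w = 0"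
    if "w = u \<or> w = v" for w
    using that 1 2 unfolding e by (elim disjE) algebra+
  ultimately show ?thesis
    by fastforce
qed

end

lemma weighted_integral_functional:
  assumes "\<alpha> > -1" and "monic_orthogonal_polys \<alpha> t P"
  shows "even_semiclassical_functional (weighted_integral \<alpha> t) \<alpha> t P"
proof
  have P: "degree (P n) = n" "lead_coeff (P n) = 1"
    and orth: "m \<noteq> n \<Longrightarrow> (LINT x:{-1..1}|lborel. poly (P m) x * poly (P n) x * jacobi_weight \<alpha> t x) = 0" for m n
    using assms(2) unfolding monic_orthogonal_polys_def by blast+
  show "degree (P n) = n" for n
    by (rule P)
  show "coeff (P n) n = 1" for n
    using P(2)[of n] unfolding P(1) .
  show "weighted_integral \<alpha> t (P m * P n) = 0" if "m \<noteq> n" for m n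
    using orth[OF that] by (simp add: weighted_integral_def)
qed (rule weighted_integral_add weighted_integral_smult weighted_integral_square_pos
      weighted_integral_reflect weighted_integral_contract weighted_integral_pearson; (rule assms)?; assumption?)+

section \<open>Asymptotic expansions in powers of 1/n\<close>

text \<open>Both \<^const>\<open>vec_nth\<close> and \<^const>\<open>fps_nth\<close> are written with a dollar sign; from here on it means the latter.\<close>

unbundle no vec_syntax
unbundle fps_syntax

text \<open>An expansion of \<open>f n\<close> to order \<open>N\<close> in powers of \<open>1/n\<close>, whose coefficients are the first \<open>N\<close> ones of \<open>F\<close>.
  The approximating polynomial may have arbitrary further terms, so that a product of approximants
  approximates the product without truncation.  For \<open>N = 0\<close> the condition is boundedness.\<close>

definition asymp_expansion :: "nat \<Rightarrow> (nat \<Rightarrow> real) \<Rightarrow> real fps \<Rightarrow> bool" where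
  "asymp_expansion N f F \<longleftrightarrow> (\<exists>q. (\<forall>j<N. coeff q j = F $ j) \<and>
     (\<lambda>n. f n - poly q (1 / real n)) \<in> O(\<lambda>n. 1 / real n ^ N))"

lemma poly_at_inverse_tendsto: "(\<lambda>n. poly q (1 / real n)) \<longlonglongrightarrow> coeff q 0"
proof -
  have "(\<lambda>n. poly q (1 / real n)) \<longlonglongrightarrow> poly q 0"
    by (intro tendsto_intros lim_1_over_n)
  then show ?thesis
    by (simp add: poly_0_coeff_0)
qed

lemma poly_at_inverse_bounded: "(\<lambda>n. poly q (1 / real n)) \<in> O(\<lambda>_. 1)"
  using poly_at_inverse_tendsto[of q] by (intro bigoI_tendsto[where c = "coeff q 0"]) auto

lemma high_order_poly_bigo:
  assumes "\<And>j. j < N \<Longrightarrow> coeff q j = 0"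
  shows "(\<lambda>n. poly q (1 / real n)) \<in> O(\<lambda>n. 1 / real n ^ N)"
proof -
  have "monom 1 N dvd q"
    using assms by (auto simp: monom_1_dvd_iff')
  then obtain s where s: "q = monom 1 N * s" ..
  have "(\<lambda>n. 1 / real n ^ N * poly s (1 / real n)) \<in> O(\<lambda>n. 1 / real n ^ N * 1)"
    by (intro landau_o.big.mult landau_o.big_refl poly_at_inverse_bounded)
  then show ?thesis
    by (simp add: s poly_monom power_one_over)
qed

lemma asymp_expansion_any_poly:
  assumes "asymp_expansion N f F" and "\<And>j. j < N \<Longrightarrow> coeff q j = F $ j"
  shows "(\<lambda>n. f n - poly q (1 / real n)) \<in> O(\<lambda>n. 1 / real n ^ N)"
proof -
  obtain r where r: "\<forall>j<N. coeff r j = F $ j"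
      "(\<lambda>n. f n - poly r (1 / real n)) \<in> O(\<lambda>n. 1 / real n ^ N)"
    using assms(1) by (auto simp: asymp_expansion_def)
  have "(\<lambda>n. poly (r - q) (1 / real n)) \<in> O(\<lambda>n. 1 / real n ^ N)"
    by (rule high_order_poly_bigo) (use r(1) assms(2) in simp)
  from sum_in_bigo(1)[OF r(2) this] show ?thesis
    by simp
qed

lemma asymp_expansion_partial_sum:
  assumes "asymp_expansion N f F"
  shows "(\<lambda>n. f n - (\<Sum>j<N. F $ j / real n ^ j)) \<in> O(\<lambda>n. 1 / real n ^ N)"
proof -
  define q where "q = (\<Sum>i<N. monom (F $ i) i)"
  have "poly q (1 / real n) = (\<Sum>j<N. F $ j / real n ^ j)" for n
    by (simp add: q_def poly_sum poly_monom divide_inverse power_inverse)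
  moreover have "coeff q j = F $ j" if "j < N" for j
    using that by (simp add: q_def coeff_sum if_distrib cong: if_cong)
  ultimately show ?thesis
    using asymp_expansion_any_poly[OF assms, of q] by simp
qed

lemma truncation_poly_exists: "\<exists>q. \<forall>j<N. coeff q j = (F :: real fps) $ j"
  by (rule exI[of _ "\<Sum>i<N. monom (F $ i) i"]) (simp add: coeff_sum if_distrib cong: if_cong)

lemma asymp_expansion_mono: "asymp_expansion N f F \<Longrightarrow> M \<le> N \<Longrightarrow> asymp_expansion M f F"
proof -
  assume N: "asymp_expansion N f F" and MN: "M \<le> N"
  obtain q where q: "\<forall>j<N. coeff q j = F $ j"
      "(\<lambda>n. f n - poly q (1 / real n)) \<in> O(\<lambda>n. 1 / real n ^ N)"
    using N by (auto simp: asymp_expansion_def)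
  have "(\<lambda>n. 1 / real n ^ N) \<in> O(\<lambda>n. 1 / real n ^ M)"
  proof (rule bigoI[of _ 1])
    show "\<forall>\<^sub>F n in sequentially. norm (1 / real n ^ N) \<le> 1 * norm (1 / real n ^ M)"
      using eventually_gt_at_top[of 0]
      by eventually_elim (auto intro!: divide_left_mono power_increasing MN)
  qed
  with q MN show ?thesis
    unfolding asymp_expansion_def by (meson landau_o.big.trans order_less_le_trans)
qed

lemma asymp_expansion_cong:
  assumes "asymp_expansion N f F" and "\<forall>\<^sub>F n in sequentially. f n = g n"
  shows "asymp_expansion N g F"
proof -
  have "(\<lambda>n. f n - poly q (1 / real n)) \<in> O(h) \<longleftrightarrow> (\<lambda>n. g n - poly q (1 / real n)) \<in> O(h)" for q h
    by (rule landau_o.big.in_cong) (use assms(2) in eventually_elim, simp)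
  then show ?thesis
    using assms(1) by (simp add: asymp_expansion_def)
qed

lemma asymp_expansion_poly: "asymp_expansion N (\<lambda>n. poly q (1 / real n)) (fps_of_poly q)"
  unfolding asymp_expansion_def by (rule exI[of _ q]) simp

lemma asymp_expansion_const: "asymp_expansion N (\<lambda>_. c) (fps_const c)"
  using asymp_expansion_poly[of N "[:c:]"] by (simp add: fps_of_poly_const)

lemma asymp_expansion_inverse_n: "asymp_expansion N (\<lambda>n. 1 / real n) fps_X"
  using asymp_expansion_poly[of N "[:0, 1:]"] by simp

lemma asymp_expansion_add:
  assumes "asymp_expansion N f F" "asymp_expansion N g G"
  shows "asymp_expansion N (\<lambda>n. f n + g n) (F + G)"
proof -
  obtain p q where "\<forall>j<N. coeff p j = F $ j" "\<forall>j<N. coeff q j = G $ j"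
      and O: "(\<lambda>n. f n - poly p (1 / real n)) \<in> O(\<lambda>n. 1 / real n ^ N)"
      "(\<lambda>n. g n - poly q (1 / real n)) \<in> O(\<lambda>n. 1 / real n ^ N)"
    using assms by (auto simp: asymp_expansion_def)
  with sum_in_bigo(1)[OF O] show ?thesis
    unfolding asymp_expansion_def by (intro exI[of _ "p + q"]) (simp add: algebra_simps)
qed

lemma asymp_expansion_bounded:
  assumes "asymp_expansion N f F"
  shows "f \<in> O(\<lambda>_. 1)"
proof -
  obtain p where "(\<lambda>n. f n - poly p (1 / real n)) \<in> O(\<lambda>n. 1)"
    using asymp_expansion_mono[OF assms, of 0] by (auto simp: asymp_expansion_def)
  from sum_in_bigo(1)[OF this poly_at_inverse_bounded[of p]] show ?thesis
    by simp
qed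

lemma asymp_expansion_mult:
  assumes "asymp_expansion N f F" "asymp_expansion N g G"
  shows "asymp_expansion N (\<lambda>n. f n * g n) (F * G)"
proof -
  obtain p q where pq: "\<forall>j<N. coeff p j = F $ j" "\<forall>j<N. coeff q j = G $ j"
      and O: "(\<lambda>n. f n - poly p (1 / real n)) \<in> O(\<lambda>n. 1 / real n ^ N)"
      "(\<lambda>n. g n - poly q (1 / real n)) \<in> O(\<lambda>n. 1 / real n ^ N)"
    using assms by (auto simp: asymp_expansion_def)
  have "(\<lambda>n. (f n - poly p (1 / real n)) * g n) \<in> O(\<lambda>n. 1 / real n ^ N * 1)"
    by (intro landau_o.big.mult O asymp_expansion_bounded[OF assms(2)])
  moreover have "(\<lambda>n. (g n - poly q (1 / real n)) * poly p (1 / real n)) \<in> O(\<lambda>n. 1 / real n ^ N * 1)"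
    by (intro landau_o.big.mult O poly_at_inverse_bounded)
  ultimately have "(\<lambda>n. f n * g n - poly (p * q) (1 / real n)) \<in> O(\<lambda>n. 1 / real n ^ N)"
    using sum_in_bigo(1) by (fastforce simp: algebra_simps)
  moreover have "\<forall>j<N. coeff (p * q) j = (F * G) $ j"
    using pq by (auto simp: coeff_mult fps_mult_nth atLeast0AtMost intro!: sum.cong)
  ultimately show ?thesis
    unfolding asymp_expansion_def by blast
qed

lemma asymp_expansion_diff:
  assumes "asymp_expansion N f F" "asymp_expansion N g G"
  shows "asymp_expansion N (\<lambda>n. f n - g n) (F - G)"
  using asymp_expansion_add[OF assms(1) asymp_expansion_mult[OF asymp_expansion_const[of N "-1"] assms(2)]]
  by (simp flip: fps_const_neg)

lemma asymp_expansion_imp_tendsto: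
  assumes "asymp_expansion N f F" and "N > 0"
  shows "f \<longlonglongrightarrow> F $ 0"
proof -
  have "asymp_expansion 1 f F"
    using assms by (auto intro: asymp_expansion_mono)
  then obtain p where p: "coeff p 0 = F $ 0" "(\<lambda>n. f n - poly p (1 / real n)) \<in> O(\<lambda>n. 1 / real n)"
    by (auto simp: asymp_expansion_def)
  have "(\<lambda>n. 1 / real n) \<in> o(\<lambda>_. 1)"
    by (rule smalloI_tendsto) (simp_all add: lim_1_over_n)
  with p(2) have "(\<lambda>n. f n - poly p (1 / real n)) \<in> o(\<lambda>_. 1)"
    by (rule landau_o.big_small_trans)
  then have "(\<lambda>n. f n - poly p (1 / real n)) \<longlonglongrightarrow> 0"
    by (auto dest: smalloD_tendsto)
  from tendsto_add[OF this poly_at_inverse_tendsto[of p]] show ?thesis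
    by (simp add: p)
qed

text \<open>If \<open>q\<close> approximates \<open>f\<close> and \<open>r\<close> truncates \<open>inverse F\<close>, then \<open>q r\<close> is 1 up to terms of order \<open>N\<close>, hence so
  is \<open>f r\<close>; dividing by \<open>f\<close>, which stays away from zero, gives the claim.\<close>

lemma asymp_expansion_inverse:
  assumes "asymp_expansion N f F" and "N > 0" and "F $ 0 \<noteq> 0"
  shows "asymp_expansion N (\<lambda>n. inverse (f n)) (inverse F)"
proof -
  obtain q r where q: "\<forall>j<N. coeff q j = F $ j" and r: "\<forall>j<N. coeff r j = inverse F $ j"
    using truncation_poly_exists by metis
  have qr: "coeff (1 - q * r) j = 0" if "j < N" for j
  proof -
    have "coeff (q * r) j = (F * inverse F) $ j"
      using q r that by (auto simp: coeff_mult fps_mult_nth atLeast0AtMost intro!: sum.cong)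
    also have "\<dots> = coeff 1 j"
      by (simp add: inverse_mult_eq_1' assms(3))
    finally show ?thesis by simp
  qed
  have lim: "f \<longlonglongrightarrow> F $ 0"
    by (rule asymp_expansion_imp_tendsto[OF assms(1,2)])
  have inv: "(\<lambda>n. inverse (f n)) \<in> O(\<lambda>_. 1)"
    using tendsto_inverse[OF lim assms(3)] by (intro bigoI_tendsto[where c = "inverse (F $ 0)"]) auto
  have "(\<lambda>n. poly (1 - q * r) (1 / real n)) \<in> O(\<lambda>n. 1 / real n ^ N)"
    by (rule high_order_poly_bigo) (rule qr)
  moreover have "(\<lambda>n. (f n - poly q (1 / real n)) * poly r (1 / real n)) \<in> O(\<lambda>n. 1 / real n ^ N * 1)"
    by (intro landau_o.big.mult asymp_expansion_any_poly[OF assms(1)] poly_at_inverse_bounded) (use q in simp)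
  ultimately have "(\<lambda>n. 1 - f n * poly r (1 / real n)) \<in> O(\<lambda>n. 1 / real n ^ N)"
    using sum_in_bigo(2) by (fastforce simp: algebra_simps)
  from landau_o.big.mult[OF this inv]
  have "(\<lambda>n. (1 - f n * poly r (1 / real n)) * inverse (f n)) \<in> O(\<lambda>n. 1 / real n ^ N)"
    by simp
  moreover have "\<forall>\<^sub>F n in sequentially. (1 - f n * poly r (1 / real n)) * inverse (f n)
      = inverse (f n) - poly r (1 / real n)"
    using tendsto_imp_eventually_ne[OF lim assms(3)] by eventually_elim (simp add: field_simps)
  ultimately have "(\<lambda>n. inverse (f n) - poly r (1 / real n)) \<in> O(\<lambda>n. 1 / real n ^ N)"
    by (rule landau_o.big.in_cong[THEN iffD1, rotated])
  with r show ?thesis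
    unfolding asymp_expansion_def by blast
qed

text \<open>The gain of one order here is what drives the bootstrapping of the recurrence coefficients.\<close>

lemma asymp_expansion_divide_n:
  assumes "asymp_expansion N f F"
  shows "asymp_expansion (Suc N) (\<lambda>n. f n / real n) (fps_X * F)"
proof -
  obtain q where q: "\<forall>j<N. coeff q j = F $ j"
      "(\<lambda>n. f n - poly q (1 / real n)) \<in> O(\<lambda>n. 1 / real n ^ N)"
    using assms by (auto simp: asymp_expansion_def)
  have "(\<lambda>n. (1 / real n) * (f n - poly q (1 / real n))) \<in> O(\<lambda>n. (1 / real n) * (1 / real n ^ N))"
    by (intro landau_o.big.mult q landau_o.big_refl)
  then have "(\<lambda>n. f n / real n - poly (pCons 0 q) (1 / real n)) \<in> O(\<lambda>n. 1 / real n ^ Suc N)"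
    by (simp add: algebra_simps)
  moreover have "\<forall>j<Suc N. coeff (pCons 0 q) j = (fps_X * F) $ j"
    using q(1) by (auto simp: coeff_pCons split: nat.split)
  ultimately show ?thesis
    unfolding asymp_expansion_def by blast
qed

lemma asymp_expansion_poly_compose:
  assumes "asymp_expansion N u U" and "U $ 0 = 0"
  shows "asymp_expansion N (\<lambda>n. poly q (u n)) (fps_of_poly q oo U)"
proof (induction q)
  case 0
  show ?case using asymp_expansion_const[of N 0] by simp
next
  case (pCons a q)
  have "asymp_expansion N (\<lambda>n. a + poly q (u n) * u n) (fps_const a + (fps_of_poly q oo U) * U)"
    by (intro asymp_expansion_add asymp_expansion_mult asymp_expansion_const pCons.IH assms)
  then show ?case
    by (simp add: fps_of_poly_pCons fps_compose_add_distrib fps_compose_mult_distrib assms(2) mult.commute)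
qed

text \<open>For a shift \<open>\<phi>\<close> of the argument: an expansion in \<open>1 / \<phi> n\<close>, where \<open>1 / \<phi> n\<close> itself expands in \<open>1/n\<close>, is
  re-expanded by composing the series.\<close>

lemma asymp_expansion_subst:
  assumes f: "asymp_expansion N f F" and u: "asymp_expansion N (\<lambda>n. 1 / real (\<phi> n)) U" and U0: "U $ 0 = 0"
    and \<phi>: "filterlim \<phi> at_top sequentially" and small: "(\<lambda>n. 1 / real (\<phi> n)) \<in> O(\<lambda>n. 1 / real n)"
  shows "asymp_expansion N (\<lambda>n. f (\<phi> n)) (F oo U)"
proof -
  obtain q where q: "\<forall>j<N. coeff q j = F $ j"
    using truncation_poly_exists by metis
  obtain r where r: "\<forall>j<N. coeff r j = (fps_of_poly q oo U) $ j"
      "(\<lambda>n. poly q (1 / real (\<phi> n)) - poly r (1 / real n)) \<in> O(\<lambda>n. 1 / real n ^ N)"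
    using asymp_expansion_poly_compose[OF u U0, of q] by (auto simp: asymp_expansion_def)
  have "(\<lambda>n. f (\<phi> n) - poly q (1 / real (\<phi> n))) \<in> O(\<lambda>n. (1 / real (\<phi> n)) ^ N)"
    using landau_o.big.compose[OF asymp_expansion_any_poly[OF f, of q] \<phi>] q by (simp add: power_one_over)
  also have "(\<lambda>n. (1 / real (\<phi> n)) ^ N) \<in> O(\<lambda>n. (1 / real n) ^ N)"
    by (intro landau_o.big_power small)
  finally have "(\<lambda>n. f (\<phi> n) - poly q (1 / real (\<phi> n))) \<in> O(\<lambda>n. 1 / real n ^ N)"
    by (simp add: power_one_over)
  from sum_in_bigo(1)[OF this r(2)]
  have "(\<lambda>n. f (\<phi> n) - poly r (1 / real n)) \<in> O(\<lambda>n. 1 / real n ^ N)"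
    by simp
  moreover have "\<forall>j<N. coeff r j = (F oo U) $ j"
    using r(1) q by (auto simp: fps_compose_nth intro!: sum.cong)
  ultimately show ?thesis
    unfolding asymp_expansion_def by blast
qed

text \<open>The expansion of \<open>1 / (n + c)\<close> in powers of \<open>1/n\<close>.\<close>

definition shift_fps :: "real \<Rightarrow> real fps" where
  "shift_fps c = fps_X * inverse (1 + fps_const c * fps_X)"

lemma asymp_expansion_inverse_shift:
  "asymp_expansion N (\<lambda>n. 1 / (real n + c)) (shift_fps c)"
proof -
  have "asymp_expansion (Suc N) (\<lambda>n. 1 + c * (1 / real n)) (1 + fps_const c * fps_X)"
    using asymp_expansion_add[OF asymp_expansion_const[of _ 1] asymp_expansion_mult[OF asymp_expansion_const asymp_expansion_inverse_n]]
    by simp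
  then have "asymp_expansion (Suc N) (\<lambda>n. 1 / real n * inverse (1 + c * (1 / real n))) (shift_fps c)"
    unfolding shift_fps_def by (intro asymp_expansion_mult asymp_expansion_inverse_n asymp_expansion_inverse) auto
  then have "asymp_expansion N (\<lambda>n. 1 / real n * inverse (1 + c * (1 / real n))) (shift_fps c)"
    by (rule asymp_expansion_mono) simp
  then show ?thesis
  proof (rule asymp_expansion_cong)
    show "\<forall>\<^sub>F n in sequentially. 1 / real n * inverse (1 + c * (1 / real n)) = 1 / (real n + c)"
      using eventually_gt_at_top[of 0] by eventually_elim (simp add: field_simps)
  qed
qed

lemma shift_fps_nth_0 [simp]: "shift_fps c $ 0 = 0"
  by (simp add: shift_fps_def)

lemma asymp_expansion_Suc:
  assumes "asymp_expansion N f F"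
  shows "asymp_expansion N (\<lambda>n. f (Suc n)) (F oo shift_fps 1)"
proof (rule asymp_expansion_subst[OF assms])
  show "asymp_expansion N (\<lambda>n. 1 / real (Suc n)) (shift_fps 1)"
    using asymp_expansion_inverse_shift[of N 1] by (simp add: add.commute)
  show "(\<lambda>n. 1 / real (Suc n)) \<in> O(\<lambda>n. 1 / real n)"
  proof (rule bigoI[of _ 1])
    show "\<forall>\<^sub>F n in sequentially. norm (1 / real (Suc n)) \<le> 1 * norm (1 / real n)"
      using eventually_gt_at_top[of 0] by eventually_elim (simp add: field_simps)
  qed
qed (auto simp: filterlim_Suc)

lemma asymp_expansion_pred:
  assumes "asymp_expansion N f F"
  shows "asymp_expansion N (\<lambda>n. f (n - 1)) (F oo shift_fps (-1))"
proof (rule asymp_expansion_subst[OF assms])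
  show "asymp_expansion N (\<lambda>n. 1 / real (n - 1)) (shift_fps (-1))"
  proof (rule asymp_expansion_cong[OF asymp_expansion_inverse_shift])
    show "\<forall>\<^sub>F n in sequentially. 1 / (real n + - 1) = 1 / real (n - 1)"
      using eventually_gt_at_top[of 0] by eventually_elim (simp add: of_nat_diff)
  qed
  show "(\<lambda>n. 1 / real (n - 1)) \<in> O(\<lambda>n. 1 / real n)"
  proof (rule bigoI[of _ 2])
    show "\<forall>\<^sub>F n in sequentially. norm (1 / real (n - 1)) \<le> 2 * norm (1 / real n)"
      using eventually_gt_at_top[of 1] by eventually_elim (simp add: field_simps of_nat_diff)
  qed
qed (auto simp: filterlim_minus_const_nat_at_top)

text \<open>The difference of two approximants is a polynomial in \<open>1/n\<close> that tends to zero faster than its first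
  possibly nonzero term.\<close>

lemma asymp_expansion_unique:
  assumes "asymp_expansion N f F" "asymp_expansion N f G" "j < N"
  shows "F $ j = G $ j"
  using assms(3)
proof (induction j rule: less_induct)
  case (less j)
  obtain q where q: "\<forall>i<Suc j. coeff q i = (F - G) $ i"
      and O: "(\<lambda>n. f n - f n - poly q (1 / real n)) \<in> O(\<lambda>n. 1 / real n ^ Suc j)"
    using asymp_expansion_mono[OF asymp_expansion_diff[OF assms(1,2)], of "Suc j"] less.prems
    unfolding asymp_expansion_def by (meson Suc_leI)
  have "monom 1 j dvd q"
    unfolding monom_1_dvd_iff' using q less by simp
  then obtain s where s: "q = monom 1 j * s" ..
  have "(\<lambda>n. 1 / real n ^ j * poly s (1 / real n)) \<in> O(\<lambda>n. 1 / real n ^ j * (1 / real n))"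
    using O by (simp add: s poly_monom power_one_over mult.commute)
  then have "(\<lambda>n. poly s (1 / real n)) \<in> O(\<lambda>n. 1 / real n)"
  proof (subst (asm) landau_o.big.mult_cancel_left)
    show "(\<lambda>n. 1 / real n ^ j) \<in> \<Theta>(\<lambda>n. 1 / real n ^ j)" by simp
    show "\<forall>\<^sub>F n in sequentially. 1 / real n ^ j \<noteq> 0"
      using eventually_gt_at_top[of 0] by eventually_elim simp
  qed auto
  moreover have "(\<lambda>n. 1 / real n) \<in> o(\<lambda>_. 1)"
    by (rule smalloI_tendsto) (simp_all add: lim_1_over_n)
  ultimately have "(\<lambda>n. poly s (1 / real n)) \<in> o(\<lambda>_. 1)"
    by (rule landau_o.big_small_trans)
  then have "(\<lambda>n. poly s (1 / real n)) \<longlonglongrightarrow> 0"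
    by (auto dest: smalloD_tendsto)
  then have "coeff s 0 = 0"
    by (rule LIMSEQ_unique[OF poly_at_inverse_tendsto])
  then have "coeff q j = 0"
    by (simp add: s coeff_monom_mult)
  with q show ?case by simp
qed

text \<open>By uniqueness the expansions of different orders fit together to one series.\<close>

lemma asymp_expansion_all_orders:
  assumes "\<And>N. \<exists>F. asymp_expansion N f F"
  shows "\<exists>F. \<forall>N. asymp_expansion N f F"
proof -
  obtain \<F> where \<F>: "asymp_expansion N f (\<F> N)" for N
    using assms by metis
  define F where "F = Abs_fps (\<lambda>j. \<F> (Suc j) $ j)"
  have "F $ j = \<F> N $ j" if "j < N" for j N
    using asymp_expansion_unique[OF \<F> asymp_expansion_mono[OF \<F>, of "Suc j" N], of j] that by (simp add: F_def)
  then have "asymp_expansion N f F" for N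
    using \<F>[of N] by (simp add: asymp_expansion_def)
  then show ?thesis by blast
qed

section \<open>The recurrence coefficients\<close>

text \<open>Binomial series of \<open>X^(i + 1) / (1 + c X)^(i + 1)\<close>.  Writing \<open>1 + c X\<close> on the other side gives a recursion
  in \<open>i\<close> and \<open>n\<close>, which is that of Pascal's triangle up to the powers of \<open>- c\<close>.\<close>

lemma shift_fps_power_nth: "(shift_fps c ^ Suc i) $ Suc n = (- c) ^ (n - i) * real (n choose i)"
proof (induction n arbitrary: i)
  have "shift_fps c * (1 + fps_const c * fps_X) = fps_X * (inverse (1 + fps_const c * fps_X) * (1 + fps_const c * fps_X))"
    by (simp add: shift_fps_def mult.assoc)
  also have "\<dots> = fps_X"
    by (subst inverse_mult_eq_1) auto
  finally have "shift_fps c ^ Suc i * (1 + fps_const c * fps_X) = shift_fps c ^ i * fps_X" for i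
    by (simp add: mult.assoc mult.left_commute)
  moreover have "(U * (1 + fps_const c * fps_X)) $ Suc n = U $ Suc n + c * U $ n" for U n
    by (simp add: distrib_left mult.left_commute[of U])
  moreover have "(U * fps_X) $ Suc n = U $ n" for U :: "real fps" and n
    by simp
  ultimately have step: "(shift_fps c ^ Suc i) $ Suc n = (shift_fps c ^ i) $ n - c * (shift_fps c ^ Suc i) $ n" for i n
    by (smt (verit))
  {
    case 0
    show ?case using step[of i 0] by (cases i) simp_all
  next
    case (Suc n)
    show ?case
    proof (cases i)
      case 0
      then show ?thesis using step[of 0 "Suc n"] Suc.IH[of 0] by simp
    next
      case i: (Suc j)
      have "(- c) ^ (n - j) = - c * (- c) ^ (n - Suc j)" if "j < n"
        using that by (metis Suc_diff_Suc power_Suc)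
      then show ?thesis
        unfolding i step[of _ "Suc n"] Suc.IH
        by (cases "j < n") (auto simp: algebra_simps binomial_eq_0)
    qed
  }
qed

lemma fps_compose_shift_nth:
  "(F oo shift_fps c) $ Suc n = (\<Sum>i\<le>n. F $ Suc i * ((- c) ^ (n - i) * real (n choose i)))"
proof -
  have "(F oo shift_fps c) $ Suc n = (\<Sum>i\<le>Suc n. F $ i * (shift_fps c ^ i) $ Suc n)"
    by (simp add: fps_compose_nth atLeast0AtMost)
  also have "\<dots> = (\<Sum>i\<le>n. F $ Suc i * (shift_fps c ^ Suc i) $ Suc n)"
    by (subst sum.atMost_Suc_shift) simp
  finally show ?thesis
    by (simp only: shift_fps_power_nth)
qed

text \<open>With \<open>a = 1 + 2 * \<alpha>\<close>, \<open>s = 1\<close> the series of \<open>R n / n\<close>, and with \<open>a = 2 * \<alpha> - 1\<close>, \<open>s = - 1\<close> that of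
  \<open>R (n - 1) / n\<close>, when \<open>F\<close> is the series of \<open>\<beta>\<close>.\<close>

definition denominator_fps :: "real \<Rightarrow> real \<Rightarrow> real \<Rightarrow> real fps \<Rightarrow> real fps" where
  "denominator_fps t a s F = fps_const 2 + fps_X * (fps_const a - fps_const (2 * t) * (F + (F oo shift_fps s)))"

text \<open>The series of \<open>(n + a - 2 * t * \<beta> n) / n\<close>.\<close>

definition numerator_fps :: "real \<Rightarrow> real \<Rightarrow> real fps \<Rightarrow> real fps" where
  "numerator_fps t a F = fps_const 1 + fps_X * (fps_const a - fps_const (2 * t) * F)"

lemma expansion_numerator:
  assumes "asymp_expansion N \<beta> F"
  shows "asymp_expansion (Suc N) (\<lambda>n. 1 + (a - 2 * t * \<beta> n) / real n) (numerator_fps t a F)"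
  unfolding numerator_fps_def
  by (intro asymp_expansion_add asymp_expansion_const asymp_expansion_divide_n
      asymp_expansion_diff asymp_expansion_mult assms)

lemma expansion_denominator:
  assumes "asymp_expansion N \<beta> F" and "asymp_expansion N \<gamma> (F oo shift_fps s)"
  shows "asymp_expansion (Suc N) (\<lambda>n. 2 + (a - 2 * t * (\<beta> n + \<gamma> n)) / real n) (denominator_fps t a s F)"
  unfolding denominator_fps_def
  by (intro asymp_expansion_add asymp_expansion_const asymp_expansion_divide_n
      asymp_expansion_diff asymp_expansion_mult assms)

text \<open>Bootstrapping: the equation has the form \<open>\<beta> n = E n / D n\<close> where \<open>E\<close> and \<open>D\<close> involve \<open>\<beta>\<close> only with a factor
  \<open>1/n\<close>, so \<open>E\<close> and \<open>D\<close> are known to one order more than \<open>\<beta>\<close>, and then so is \<open>\<beta>\<close>.\<close>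

lemma recurrence_coefficient_expansion:
  fixes \<beta> :: "nat \<Rightarrow> real" and \<alpha> t :: real
  assumes bounded: "\<beta> \<in> O(\<lambda>_. 1)"
    and eq: "\<forall>\<^sub>F n in sequentially. \<beta> n
        * ((2 + (1 + 2 * \<alpha> - 2 * t * (\<beta> n + \<beta> (Suc n))) / real n)
          * (2 + (2 * \<alpha> - 1 - 2 * t * (\<beta> n + \<beta> (n - 1))) / real n))
      = (1 + (0 - 2 * t * \<beta> n) / real n) * (1 + (2 * \<alpha> - 2 * t * \<beta> n) / real n)"
  obtains F where "\<And>N. asymp_expansion N \<beta> F"
    and "F * (denominator_fps t (1 + 2 * \<alpha>) 1 F * denominator_fps t (2 * \<alpha> - 1) (- 1) F)
      = numerator_fps t 0 F * numerator_fps t (2 * \<alpha>) F"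
proof -
  define D where "D n = (2 + (1 + 2 * \<alpha> - 2 * t * (\<beta> n + \<beta> (Suc n))) / real n)
    * (2 + (2 * \<alpha> - 1 - 2 * t * (\<beta> n + \<beta> (n - 1))) / real n)" for n
  define E where "E n = (1 + (0 - 2 * t * \<beta> n) / real n) * (1 + (2 * \<alpha> - 2 * t * \<beta> n) / real n)" for n
  define \<D> where "\<D> F = denominator_fps t (1 + 2 * \<alpha>) 1 F * denominator_fps t (2 * \<alpha> - 1) (- 1) F" for F
  define \<E> where "\<E> F = numerator_fps t 0 F * numerator_fps t (2 * \<alpha>) F" for F
  have eq': "\<forall>\<^sub>F n in sequentially. \<beta> n * D n = E n"
    using eq by (simp add: D_def E_def)
  have D: "asymp_expansion (Suc N) D (\<D> F)" if "asymp_expansion N \<beta> F" for N F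
    unfolding D_def \<D>_def using that
    by (intro asymp_expansion_mult expansion_denominator asymp_expansion_Suc asymp_expansion_pred)
  have E: "asymp_expansion (Suc N) E (\<E> F)" if "asymp_expansion N \<beta> F" for N F
    unfolding E_def \<E>_def using that by (intro asymp_expansion_mult expansion_numerator)
  have D0: "\<D> F $ 0 \<noteq> 0" for F
    by (simp add: \<D>_def denominator_fps_def)
  have "\<exists>F. asymp_expansion N \<beta> F" for N
  proof (induction N)
    case 0
    have "asymp_expansion 0 \<beta> 0"
      unfolding asymp_expansion_def using bounded by (intro exI[of _ 0]) simp
    then show ?case ..
  next
    case (Suc N)
    then obtain F where F: "asymp_expansion N \<beta> F" ..
    have "asymp_expansion (Suc N) (\<lambda>n. E n * inverse (D n)) (\<E> F * inverse (\<D> F))"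
      by (intro asymp_expansion_mult asymp_expansion_inverse D E F D0) simp
    moreover have "\<forall>\<^sub>F n in sequentially. D n \<noteq> 0"
      by (rule tendsto_imp_eventually_ne[OF asymp_expansion_imp_tendsto[OF D[OF F]] D0]) simp
    then have "\<forall>\<^sub>F n in sequentially. E n * inverse (D n) = \<beta> n"
      using eq' by eventually_elim (simp add: field_simps)
    ultimately show ?case
      by (blast intro: asymp_expansion_cong)
  qed
  then obtain F where F: "\<And>N. asymp_expansion N \<beta> F"
    using asymp_expansion_all_orders by blast
  have "F * \<D> F = \<E> F"
  proof (rule fps_ext)
    fix j
    have "asymp_expansion (Suc j) (\<lambda>n. \<beta> n * D n) (F * \<D> F)"
      by (intro asymp_expansion_mult F D)
    then have "asymp_expansion (Suc j) E (F * \<D> F)"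
      using eq' by (rule asymp_expansion_cong)
    then show "(F * \<D> F) $ j = \<E> F $ j"
      using E[OF F] by (rule asymp_expansion_unique) simp
  qed
  with F show ?thesis
    by (intro that) (auto simp: \<D>_def \<E>_def)
qed

lemma fps_mult_nth_upto_6:
  fixes f g :: "real fps"
  shows "(f * g) $ 0 = f $ 0 * g $ 0"
    "(f * g) $ 1 = f $ 0 * g $ 1 + f $ 1 * g $ 0"
    "(f * g) $ 2 = f $ 0 * g $ 2 + f $ 1 * g $ 1 + f $ 2 * g $ 0"
    "(f * g) $ 3 = f $ 0 * g $ 3 + f $ 1 * g $ 2 + f $ 2 * g $ 1 + f $ 3 * g $ 0"
    "(f * g) $ 4 = f $ 0 * g $ 4 + f $ 1 * g $ 3 + f $ 2 * g $ 2 + f $ 3 * g $ 1 + f $ 4 * g $ 0"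
    "(f * g) $ 5 = f $ 0 * g $ 5 + f $ 1 * g $ 4 + f $ 2 * g $ 3 + f $ 3 * g $ 2 + f $ 4 * g $ 1 + f $ 5 * g $ 0"
    "(f * g) $ 6 = f $ 0 * g $ 6 + f $ 1 * g $ 5 + f $ 2 * g $ 4 + f $ 3 * g $ 3 + f $ 4 * g $ 2 + f $ 5 * g $ 1 + f $ 6 * g $ 0"
  by (simp_all add: fps_mult_nth numeral_eq_Suc)

lemma fps_compose_shift_nth_upto_5:
  fixes F :: "real fps"
  shows "(F oo shift_fps c) $ 1 = F $ 1"
    "(F oo shift_fps c) $ 2 = F $ 2 - c * F $ 1"
    "(F oo shift_fps c) $ 3 = F $ 3 - 2 * c * F $ 2 + c ^ 2 * F $ 1"
    "(F oo shift_fps c) $ 4 = F $ 4 - 3 * c * F $ 3 + 3 * c ^ 2 * F $ 2 - c ^ 3 * F $ 1"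
    "(F oo shift_fps c) $ 5 = F $ 5 - 4 * c * F $ 4 + 6 * c ^ 2 * F $ 3 - 4 * c ^ 3 * F $ 2 + c ^ 4 * F $ 1"
  using fps_compose_shift_nth[of F c 0] fps_compose_shift_nth[of F c 1] fps_compose_shift_nth[of F c 2]
    fps_compose_shift_nth[of F c 3] fps_compose_shift_nth[of F c 4]
  by (simp_all add: eval_nat_numeral algebra_simps)

lemma denominator_fps_nth:
  "denominator_fps t a s F $ n = (if n = 0 then 2 else
     (if n = 1 then a else 0) - 2 * t * (F $ (n - 1) + (F oo shift_fps s) $ (n - 1)))"
  by (cases n) (simp_all add: denominator_fps_def mult.assoc)

lemma numerator_fps_nth:
  "numerator_fps t a F $ n = (if n = 0 then 1 else (if n = 1 then a else 0) - 2 * t * F $ (n - 1))"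
  by (cases n) (simp_all add: numerator_fps_def mult.assoc)

text \<open>The coefficient of index \<open>k\<close> in the series equation is linear in \<open>F $ k\<close>, with factor 4, and otherwise
  involves lower coefficients only, so the coefficients are determined one after the other.  Their
  closed form in terms of the \<open>b\<close>s comes from \<open>\<beta> n = p n - p (n + 1)\<close>: the term \<open>b j / n^j\<close> of the
  subleading coefficient \<open>p\<close> contributes \<open>b j (n^(- j) - (n + 1)^(- j))\<close> to \<open>\<beta>\<close>.\<close>

lemma fps_upto_6:
  fixes F :: "real fps" and \<alpha> t :: real
  assumes "F * (denominator_fps t (1 + 2 * \<alpha>) 1 F * denominator_fps t (2 * \<alpha> - 1) (- 1) F)
      = numerator_fps t 0 F * numerator_fps t (2 * \<alpha>) F"
  defines "b\<^sub>1 \<equiv> 1 / 16 * (1 - 4 * \<alpha>\<^sup>2)"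
    and "b\<^sub>2 \<equiv> 1 / 32 * (1 - 4 * \<alpha>\<^sup>2) * (t + 1 - 2 * \<alpha>)"
    and "b\<^sub>3 \<equiv> 1 / 64 * (1 - 4 * \<alpha>\<^sup>2) * (t + 1 - 2 * \<alpha>)\<^sup>2"
    and "b\<^sub>4 \<equiv> 1 / 256 * (1 - 4 * \<alpha>\<^sup>2) *
       (2 * t ^ 3 + 6 * (1 - 2 * \<alpha>) * t\<^sup>2 + (20 * \<alpha>\<^sup>2 - 24 * \<alpha> + 15) * t
        + 2 * (1 - 2 * \<alpha>) ^ 3)"
    and "b\<^sub>5 \<equiv> 1 / 256 * (1 - 4 * \<alpha>\<^sup>2) *
       (t ^ 4 + 4 * (1 - 2 * \<alpha>) * t ^ 3 + 8 * (2 * \<alpha>\<^sup>2 - 3 * \<alpha> + 3) * t\<^sup>2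
        + 2 * (1 - 2 * \<alpha>) * (4 * \<alpha>\<^sup>2 - 8 * \<alpha> + 11) * t + (1 - 2 * \<alpha>) ^ 4)"
  shows "F $ 0 = 1 / 4" "F $ 1 = 0" "F $ 2 = b\<^sub>1" "F $ 3 = 2 * b\<^sub>2 - b\<^sub>1" "F $ 4 = 3 * b\<^sub>3 - 3 * b\<^sub>2 + b\<^sub>1"
    "F $ 5 = 4 * b\<^sub>4 - 6 * b\<^sub>3 + 4 * b\<^sub>2 - b\<^sub>1" "F $ 6 = 5 * b\<^sub>5 - 10 * b\<^sub>4 + 10 * b\<^sub>3 - 5 * b\<^sub>2 + b\<^sub>1"
proof -
  define A B M N where ABMN: "A = denominator_fps t (1 + 2 * \<alpha>) 1 F" "B = denominator_fps t (2 * \<alpha> - 1) (- 1) F"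
    "M = numerator_fps t 0 F" "N = numerator_fps t (2 * \<alpha>) F"
  have eq: "(F * (A * B)) $ k = (M * N) $ k" for k
    using assms(1) by (simp add: ABMN)
  have A: "A $ 0 = 2" "A $ 1 = 1 + 2 * \<alpha> - 4 * t * F $ 0" "A $ 2 = - 4 * t * F $ 1"
     "A $ 3 = - 2 * t * (2 * F $ 2 - F $ 1)" "A $ 4 = - 2 * t * (2 * F $ 3 - 2 * F $ 2 + F $ 1)"
     "A $ 5 = - 2 * t * (2 * F $ 4 - 3 * F $ 3 + 3 * F $ 2 - F $ 1)"
     "A $ 6 = - 2 * t * (2 * F $ 5 - 4 * F $ 4 + 6 * F $ 3 - 4 * F $ 2 + F $ 1)"
    unfolding ABMN by (simp_all add: denominator_fps_nth fps_compose_shift_nth_upto_5[unfolded One_nat_def])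
  have B: "B $ 0 = 2" "B $ 1 = 2 * \<alpha> - 1 - 4 * t * F $ 0" "B $ 2 = - 4 * t * F $ 1"
     "B $ 3 = - 2 * t * (2 * F $ 2 + F $ 1)" "B $ 4 = - 2 * t * (2 * F $ 3 + 2 * F $ 2 + F $ 1)"
     "B $ 5 = - 2 * t * (2 * F $ 4 + 3 * F $ 3 + 3 * F $ 2 + F $ 1)"
     "B $ 6 = - 2 * t * (2 * F $ 5 + 4 * F $ 4 + 6 * F $ 3 + 4 * F $ 2 + F $ 1)"
    unfolding ABMN by (simp_all add: denominator_fps_nth fps_compose_shift_nth_upto_5[unfolded One_nat_def])
  have M: "M $ 0 = 1" "M $ 1 = - 2 * t * F $ 0" "M $ 2 = - 2 * t * F $ 1" "M $ 3 = - 2 * t * F $ 2"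
     "M $ 4 = - 2 * t * F $ 3" "M $ 5 = - 2 * t * F $ 4" "M $ 6 = - 2 * t * F $ 5"
    and N: "N $ 0 = 1" "N $ 1 = 2 * \<alpha> - 2 * t * F $ 0" "N $ 2 = - 2 * t * F $ 1" "N $ 3 = - 2 * t * F $ 2"
     "N $ 4 = - 2 * t * F $ 3" "N $ 5 = - 2 * t * F $ 4" "N $ 6 = - 2 * t * F $ 5"
    unfolding ABMN by (simp_all add: numerator_fps_nth)
  show F0: "F $ 0 = 1 / 4"
    using eq[of 0] unfolding fps_mult_nth_upto_6 A B M N by simp
  show F1: "F $ 1 = 0"
    using eq[of 1] unfolding fps_mult_nth_upto_6 A B M N F0 by (simp add: algebra_simps)
  show F2: "F $ 2 = b\<^sub>1"
    using eq[of 2] unfolding fps_mult_nth_upto_6 A B M N F0 F1 b\<^sub>1_def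
    by (simp add: algebra_simps power2_eq_square)
  show F3: "F $ 3 = 2 * b\<^sub>2 - b\<^sub>1"
    using eq[of 3] unfolding fps_mult_nth_upto_6 A B M N F0 F1 F2 b\<^sub>1_def b\<^sub>2_def
    by (simp add: field_simps eval_nat_numeral)
  show F4: "F $ 4 = 3 * b\<^sub>3 - 3 * b\<^sub>2 + b\<^sub>1"
    using eq[of 4] unfolding fps_mult_nth_upto_6 A B M N F0 F1 F2 F3 b\<^sub>1_def b\<^sub>2_def b\<^sub>3_def
    by algebra
  show F5: "F $ 5 = 4 * b\<^sub>4 - 6 * b\<^sub>3 + 4 * b\<^sub>2 - b\<^sub>1"
    using eq[of 5] unfolding fps_mult_nth_upto_6 A B M N F0 F1 F2 F3 F4 b\<^sub>1_def b\<^sub>2_def b\<^sub>3_def b\<^sub>4_def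
    by algebra
  show F6: "F $ 6 = 5 * b\<^sub>5 - 10 * b\<^sub>4 + 10 * b\<^sub>3 - 5 * b\<^sub>2 + b\<^sub>1"
    using eq[of 6] unfolding fps_mult_nth_upto_6 A B M N F0 F1 F2 F3 F4 F5 b\<^sub>1_def b\<^sub>2_def b\<^sub>3_def b\<^sub>4_def b\<^sub>5_def
    by algebra
qed

section \<open>The subleading coefficient\<close>

context even_semiclassical_functional
begin

lemma \<beta>_bounded: "\<beta> \<in> O(\<lambda>_. 1)"
proof (rule bigoI[of _ 1])
  show "\<forall>\<^sub>F n in sequentially. norm (\<beta> n) \<le> 1 * norm (1 :: real)"
    using eventually_ge_at_top[of 2]
  proof eventually_elim
    case (elim n)
    then have "\<beta> n \<le> 1"
      using \<beta>_le_1[of "n - 2"] by (simp add: numeral_2_eq_2 Suc_diff_Suc)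
    then show ?case
      using \<beta>_pos[of n] by simp
  qed
qed

text \<open>The difference equation divided by \<open>n\<^sup>2\<close>, in the form to which the bootstrapping applies.\<close>

lemma normalised_discrete_equation:
  assumes "n \<ge> 4"
  shows "\<beta> n * ((2 + (1 + 2 * \<alpha> - 2 * t * (\<beta> n + \<beta> (Suc n))) / real n)
        * (2 + (2 * \<alpha> - 1 - 2 * t * (\<beta> n + \<beta> (n - 1))) / real n))
      = (1 + (0 - 2 * t * \<beta> n) / real n) * (1 + (2 * \<alpha> - 2 * t * \<beta> n) / real n)"
proof -
  have n: "real n > 0" "real (n - 1) = real n - 1" "n - 1 + 1 = n"
    using assms by (auto simp: of_nat_diff)
  have 1: "2 + (1 + 2 * \<alpha> - 2 * t * (\<beta> n + \<beta> (Suc n))) / real n = R n / real n"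
    using n(1) by (simp add: R_def field_simps)
  have 2: "2 + (2 * \<alpha> - 1 - 2 * t * (\<beta> n + \<beta> (n - 1))) / real n = R (n - 1) / real n"
    unfolding R_def n(2,3) using n(1) by (simp add: field_simps)
  have 3: "1 + (a - 2 * t * \<beta> n) / real n = (real n + a - 2 * t * \<beta> n) / real n" for a
    using n(1) by (simp add: field_simps)
  show ?thesis
    unfolding 1 2 3 using discrete_equation[OF assms] by (simp add: mult.assoc)
qed

lemma normalised_subleading:
  assumes "n \<ge> 3"
  shows "1 / 2 * (\<beta> n * (2 + (1 + 2 * \<alpha> + 2 * t - 2 * t * (\<beta> n + \<beta> (n - 1) + \<beta> (Suc n))) / real n) - 1)
    = coeff (P n) (n - 2) / real n"
proof -
  obtain k where n: "n = k + 3"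
    using assms by (metis add.commute le_Suc_ex)
  have idx: "n - 1 = k + 2" "n - 2 = k + 1" "Suc n = k + 4"
    by (simp_all add: n)
  have "2 * coeff (P n) (n - 2) = - real n
      + \<beta> n * (2 * real n + 1 + 2 * \<alpha> + 2 * t - 2 * t * (\<beta> (n - 1) + \<beta> n + \<beta> (Suc n)))"
    using subleading_formula[of k] unfolding idx unfolding n .
  then have p: "coeff (P n) (n - 2) = (- real n
      + \<beta> n * (2 * real n + 1 + 2 * \<alpha> + 2 * t - 2 * t * (\<beta> (n - 1) + \<beta> n + \<beta> (Suc n)))) / 2"
    by simp
  show ?thesis
    unfolding p using assms by (simp add: field_simps)
qed

text \<open>The series \<open>G\<close> of the subleading coefficient divided by \<open>n\<close> is a polynomial in the series of \<open>\<beta>\<close> and of its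
  two shifts; the division by \<open>n\<close> turns the linear growth into a constant term.\<close>

lemma subleading_expansion:
  obtains G where "\<And>N. asymp_expansion N (\<lambda>n. subleading P n / real n) G"
    and "G $ 0 = - 1 / 4"
    and "G $ 1 = 1 / 16 * (t + 2 + 4 * \<alpha>)"
    and "G $ 2 = 1 / 16 * (1 - 4 * \<alpha>\<^sup>2)"
    and "G $ 3 = 1 / 32 * (1 - 4 * \<alpha>\<^sup>2) * (t + 1 - 2 * \<alpha>)"
    and "G $ 4 = 1 / 64 * (1 - 4 * \<alpha>\<^sup>2) * (t + 1 - 2 * \<alpha>)\<^sup>2"
    and "G $ 5 = 1 / 256 * (1 - 4 * \<alpha>\<^sup>2) *
       (2 * t ^ 3 + 6 * (1 - 2 * \<alpha>) * t\<^sup>2 + (20 * \<alpha>\<^sup>2 - 24 * \<alpha> + 15) * t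
        + 2 * (1 - 2 * \<alpha>) ^ 3)"
    and "G $ 6 = 1 / 256 * (1 - 4 * \<alpha>\<^sup>2) *
       (t ^ 4 + 4 * (1 - 2 * \<alpha>) * t ^ 3 + 8 * (2 * \<alpha>\<^sup>2 - 3 * \<alpha> + 3) * t\<^sup>2
        + 2 * (1 - 2 * \<alpha>) * (4 * \<alpha>\<^sup>2 - 8 * \<alpha> + 11) * t + (1 - 2 * \<alpha>) ^ 4)"
proof -
  have "\<forall>\<^sub>F n in sequentially. \<beta> n
        * ((2 + (1 + 2 * \<alpha> - 2 * t * (\<beta> n + \<beta> (Suc n))) / real n)
          * (2 + (2 * \<alpha> - 1 - 2 * t * (\<beta> n + \<beta> (n - 1))) / real n))
      = (1 + (0 - 2 * t * \<beta> n) / real n) * (1 + (2 * \<alpha> - 2 * t * \<beta> n) / real n)"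
    using eventually_ge_at_top[of 4] by eventually_elim (rule normalised_discrete_equation)
  then obtain F where F: "\<And>N. asymp_expansion N \<beta> F"
    and feq: "F * (denominator_fps t (1 + 2 * \<alpha>) 1 F * denominator_fps t (2 * \<alpha> - 1) (- 1) F)
      = numerator_fps t 0 F * numerator_fps t (2 * \<alpha>) F"
    using recurrence_coefficient_expansion[OF \<beta>_bounded] by blast
  define S where "S = F + (F oo shift_fps (- 1)) + (F oo shift_fps 1)"
  define K where "K = fps_const 2 + fps_X * (fps_const (1 + 2 * \<alpha> + 2 * t) - fps_const (2 * t) * S)"
  define G where "G = fps_const (1 / 2) * (F * K - fps_const 1)"
  have G: "asymp_expansion N (\<lambda>n. subleading P n / real n) G" for N
  proof -
    have "asymp_expansion (Suc N) (\<lambda>n. 1 / 2 * (\<beta> n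
        * (2 + (1 + 2 * \<alpha> + 2 * t - 2 * t * (\<beta> n + \<beta> (n - 1) + \<beta> (Suc n))) / real n) - 1)) G"
      unfolding G_def K_def S_def
      by (intro asymp_expansion_add asymp_expansion_const asymp_expansion_divide_n asymp_expansion_diff
          asymp_expansion_mult asymp_expansion_Suc asymp_expansion_pred F)
    then have "asymp_expansion N (\<lambda>n. 1 / 2 * (\<beta> n
        * (2 + (1 + 2 * \<alpha> + 2 * t - 2 * t * (\<beta> n + \<beta> (n - 1) + \<beta> (Suc n))) / real n) - 1)) G"
      by (rule asymp_expansion_mono) simp
    then show ?thesis
    proof (rule asymp_expansion_cong)
      show "\<forall>\<^sub>F n in sequentially. 1 / 2 * (\<beta> n
        * (2 + (1 + 2 * \<alpha> + 2 * t - 2 * t * (\<beta> n + \<beta> (n - 1) + \<beta> (Suc n))) / real n) - 1)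
        = subleading P n / real n"
        using eventually_ge_at_top[of 3]
        by eventually_elim (simp only: normalised_subleading, simp add: subleading_def)
    qed
  qed
  note f = fps_upto_6[OF feq]
  note shift = fps_compose_shift_nth_upto_5
  have S: "S $ 0 = 3 * F $ 0" "S $ 1 = 3 * F $ 1" "S $ 2 = 3 * F $ 2" "S $ 3 = 3 * F $ 3 + 2 * F $ 1"
    "S $ 4 = 3 * F $ 4 + 6 * F $ 2" "S $ 5 = 3 * F $ 5 + 12 * F $ 3 + 2 * F $ 1"
    unfolding S_def fps_add_nth shift by simp_all
  have K_nth: "K $ n = (if n = 0 then 2 else
      (if n = 1 then 1 + 2 * \<alpha> + 2 * t else 0) - 2 * t * S $ (n - 1))" for n
    by (cases n) (simp_all add: K_def mult.assoc)
  have K: "K $ 0 = 2" "K $ 1 = 1 + 2 * \<alpha> + 2 * t - 2 * t * S $ 0" "K $ 2 = - 2 * t * S $ 1"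
    "K $ 3 = - 2 * t * S $ 2" "K $ 4 = - 2 * t * S $ 3" "K $ 5 = - 2 * t * S $ 4" "K $ 6 = - 2 * t * S $ 5"
    by (simp_all add: K_nth)
  have G_nth: "G $ 0 = 1 / 2 * ((F * K) $ 0 - 1)" "n > 0 \<Longrightarrow> G $ n = 1 / 2 * (F * K) $ n" for n
    by (simp_all add: G_def)
  note nth = G_nth(1) G_nth(2)[OF zero_less_numeral] G_nth(2)[OF zero_less_one] fps_mult_nth_upto_6 K S f
  show ?thesis
  proof (rule that[OF G])
    show "G $ 0 = - 1 / 4" "G $ 1 = 1 / 16 * (t + 2 + 4 * \<alpha>)" "G $ 2 = 1 / 16 * (1 - 4 * \<alpha>\<^sup>2)"
      unfolding nth by (simp_all add: field_simps)
    show "G $ 3 = 1 / 32 * (1 - 4 * \<alpha>\<^sup>2) * (t + 1 - 2 * \<alpha>)"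
      unfolding nth by (simp add: field_simps)
    show "G $ 4 = 1 / 64 * (1 - 4 * \<alpha>\<^sup>2) * (t + 1 - 2 * \<alpha>)\<^sup>2"
      unfolding nth by algebra
    show "G $ 5 = 1 / 256 * (1 - 4 * \<alpha>\<^sup>2) *
       (2 * t ^ 3 + 6 * (1 - 2 * \<alpha>) * t\<^sup>2 + (20 * \<alpha>\<^sup>2 - 24 * \<alpha> + 15) * t
        + 2 * (1 - 2 * \<alpha>) ^ 3)"
      unfolding nth by algebra
    show "G $ 6 = 1 / 256 * (1 - 4 * \<alpha>\<^sup>2) *
       (t ^ 4 + 4 * (1 - 2 * \<alpha>) * t ^ 3 + 8 * (2 * \<alpha>\<^sup>2 - 3 * \<alpha> + 3) * t\<^sup>2
        + 2 * (1 - 2 * \<alpha>) * (4 * \<alpha>\<^sup>2 - 8 * \<alpha> + 11) * t + (1 - 2 * \<alpha>) ^ 4)"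
      unfolding nth by algebra
  qed
qed

end

theorem theorem3p2:
  fixes \<alpha> t :: real and P :: "nat \<Rightarrow> real poly"
  assumes "\<alpha> > -1"
    and "monic_orthogonal_polys \<alpha> t P"
  shows "\<exists>b :: int \<Rightarrow> real.
     (\<forall>N::nat. N \<ge> 1 \<longrightarrow>
        (\<lambda>n::nat. subleading P n
            - (b (-1) * real n + b 0 + (\<Sum>j=1..N. b (int j) / real n ^ j)))
          \<in> O(\<lambda>n. 1 / real n ^ (N + 1))) \<and>
     b (-1) = - 1 / 4 \<and>
     b 0 = 1 / 16 * (t + 2 + 4 * \<alpha>) \<and>
     b 1 = 1 / 16 * (1 - 4 * \<alpha>\<^sup>2) \<and>
     b 2 = 1 / 32 * (1 - 4 * \<alpha>\<^sup>2) * (t + 1 - 2 * \<alpha>) \<and>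
     b 3 = 1 / 64 * (1 - 4 * \<alpha>\<^sup>2) * (t + 1 - 2 * \<alpha>)\<^sup>2 \<and>
     b 4 = 1 / 256 * (1 - 4 * \<alpha>\<^sup>2) *
       (2 * t ^ 3 + 6 * (1 - 2 * \<alpha>) * t\<^sup>2 + (20 * \<alpha>\<^sup>2 - 24 * \<alpha> + 15) * t
        + 2 * (1 - 2 * \<alpha>) ^ 3) \<and>
     b 5 = 1 / 256 * (1 - 4 * \<alpha>\<^sup>2) *
       (t ^ 4 + 4 * (1 - 2 * \<alpha>) * t ^ 3 + 8 * (2 * \<alpha>\<^sup>2 - 3 * \<alpha> + 3) * t\<^sup>2
        + 2 * (1 - 2 * \<alpha>) * (4 * \<alpha>\<^sup>2 - 8 * \<alpha> + 11) * t + (1 - 2 * \<alpha>) ^ 4)"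
proof -
  interpret even_semiclassical_functional "weighted_integral \<alpha> t" \<alpha> t P
    using assms by (rule weighted_integral_functional)
  obtain G where G: "\<And>N. asymp_expansion N (\<lambda>n. subleading P n / real n) G"
    and G_nth: "G $ 0 = - 1 / 4"
    "G $ 1 = 1 / 16 * (t + 2 + 4 * \<alpha>)"
    "G $ 2 = 1 / 16 * (1 - 4 * \<alpha>\<^sup>2)"
    "G $ 3 = 1 / 32 * (1 - 4 * \<alpha>\<^sup>2) * (t + 1 - 2 * \<alpha>)"
    "G $ 4 = 1 / 64 * (1 - 4 * \<alpha>\<^sup>2) * (t + 1 - 2 * \<alpha>)\<^sup>2"
    "G $ 5 = 1 / 256 * (1 - 4 * \<alpha>\<^sup>2) *
       (2 * t ^ 3 + 6 * (1 - 2 * \<alpha>) * t\<^sup>2 + (20 * \<alpha>\<^sup>2 - 24 * \<alpha> + 15) * t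
        + 2 * (1 - 2 * \<alpha>) ^ 3)"
    "G $ 6 = 1 / 256 * (1 - 4 * \<alpha>\<^sup>2) *
       (t ^ 4 + 4 * (1 - 2 * \<alpha>) * t ^ 3 + 8 * (2 * \<alpha>\<^sup>2 - 3 * \<alpha> + 3) * t\<^sup>2
        + 2 * (1 - 2 * \<alpha>) * (4 * \<alpha>\<^sup>2 - 8 * \<alpha> + 11) * t + (1 - 2 * \<alpha>) ^ 4)"
    by (rule subleading_expansion) (rule that)
  define b :: "int \<Rightarrow> real" where "b j = G $ nat (j + 1)" for j
  have b_nat: "b (int j) = G $ Suc j" for j
    by (simp add: b_def nat_add_distrib)
  have "(\<lambda>n. subleading P n - (b (-1) * real n + b 0 + (\<Sum>j=1..N. b (int j) / real n ^ j)))
      \<in> O(\<lambda>n. 1 / real n ^ (N + 1))" for N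
  proof -
    \<comment> \<open>Two orders more than the claim: one term of the sum is the linear one, and multiplication by \<open>n\<close> costs one order.\<close>
    have "(\<lambda>n. subleading P n / real n - (\<Sum>j<N + 2. G $ j / real n ^ j)) \<in> O(\<lambda>n. 1 / real n ^ (N + 2))"
      by (rule asymp_expansion_partial_sum[OF G])
    then have "(\<lambda>n. real n * (subleading P n / real n - (\<Sum>j<N + 2. G $ j / real n ^ j)))
        \<in> O(\<lambda>n. real n * (1 / real n ^ (N + 2)))"
      by (intro landau_o.big.mult_left)
    also have "(\<lambda>n. real n * (1 / real n ^ (N + 2))) = (\<lambda>n. 1 / real n ^ (N + 1))"
      by (auto simp: fun_eq_iff)
    finally show ?thesis
    proof (rule landau_o.big.in_cong[THEN iffD1, rotated])
      show "\<forall>\<^sub>F n in sequentially. real n * (subleading P n / real n - (\<Sum>j<N + 2. G $ j / real n ^ j))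
          = subleading P n - (b (-1) * real n + b 0 + (\<Sum>j=1..N. b (int j) / real n ^ j))"
        using eventually_gt_at_top[of 0]
      proof eventually_elim
        case (elim n)
        have "(\<Sum>j<N + 2. G $ j / real n ^ j) = G $ 0 + (\<Sum>j\<le>N. G $ Suc j / real n ^ Suc j)"
          by (simp only: numeral_2_eq_2 add_Suc_right add_0_right lessThan_Suc_atMost sum.atMost_Suc_shift) simp
        also have "real n * \<dots> = G $ 0 * real n + (\<Sum>j\<le>N. G $ Suc j / real n ^ j)"
          using elim by (simp add: distrib_left sum_distrib_left)
        also have "(\<Sum>j\<le>N. G $ Suc j / real n ^ j) = b 0 + (\<Sum>j=1..N. b (int j) / real n ^ j)"
          using b_nat[of 0] by (simp add: b_nat atMost_atLeast0 sum.atLeast_Suc_atMost)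
        finally show ?case
          using elim by (simp add: right_diff_distrib b_def)
      qed
    qed
  qed
  moreover have "b (-1) = G $ 0" "b 0 = G $ 1" "b 1 = G $ 2" "b 2 = G $ 3" "b 3 = G $ 4" "b 4 = G $ 5" "b 5 = G $ 6"
    by (simp_all add: b_def)
  ultimately show ?thesis
    using G_nth by (intro exI[of _ b]) simp
qed

end
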